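(* Let $\mathbb{F}_q$ be a finite field of characteristic two, let $\nu\ge 1$, $n=2\nu+2$, $$S=S_{2\nu+2}=\begin{pmatrix}0&I^{(\nu)}&&\\ I^{(\nu)}&0&&\\ &&0&1\\ &&1&1\end{pmatrix}$$ (blank entries are zero), and $$Ps_n(\mathbb{F}_q,S)=\{\,T\in\mathrm{GL}_n(\mathbb{F}_q): T\,S\,{}^tT=S\,\}.$$ Let $$P_{nk}=(X_1,\ldots,X_n)\,S\begin{pmatrix}X_1^{q^k}\\ \vdots\\ X_n^{q^k}\end{pmatrix},\quad k=0,1,2,\ldots.$$ Then $$\mathbb{F}_q(X_1,\ldots,X_n)^{Ps_n(\mathbb{F}_q,S)}=\mathbb{F}_q(P_{n1},\ldots,P_{n,n-1},X_n).$$
   Context: ${}^tT$ is the transpose of $T$; $I^{(\nu)}$ is the $\nu\times\nu$ identity matrix. Action: each $T\in\mathrm{GL}_n(\mathbb{F}_q)$ induces the $\mathbb{F}_q$-automorphism $\sigma_T$ of the rational function field $\mathbb{F}_q(X_1,\ldots,X_n)$ given by $\sigma_T(f(X_1,\ldots,X_n))=f(\sigma_T(X_1),\ldots,\sigma_T(X_n))$ with $(\sigma_T(X_1),\ldots,\sigma_T(X_n))=(X_1,\ldots,X_n)T$. For a subgroup $H\le \mathrm{GL}_n(\mathbb{F}_q)$, $\mathbb{F}_q(X_1,\ldots,X_n)^{H}=\{f:\sigma_T(f)=f\text{ for all }T\in H\}$. *)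

theory Defs
  imports
    "HOL-Library.Poly_Mapping"
    "HOL-Library.Cardinality"
    "HOL-Computational_Algebra.Fraction_Field"
    "Jordan_Normal_Form.Matrix"
begin

text \<open>
  Polynomials and rational functions in the variables \<open>Var 0, Var 1, Var 2, \<dots>\<close>.  The field of rational
  functions in \<open>n\<close> variables is the subfield of \<open>'a ratfun\<close> generated by the constants and
  \<open>Var 0, \<dots>, Var (n - 1)\<close>; the variable written \<open>X\<^sub>i\<close> in 1-based notation is \<open>Var (i - 1)\<close>,
  in accordance with the 0-based indices of vectors and matrices.
\<close>

type_synonym 'a mpol = "(nat \<Rightarrow>\<^sub>0 nat) \<Rightarrow>\<^sub>0 'a"
type_synonym 'a ratfun = "((nat \<Rightarrow>\<^sub>0 nat) \<Rightarrow>\<^sub>0 'a) fract"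

definition Const :: "'a::field \<Rightarrow> 'a ratfun" where
  "Const c = Fraction_Field.Fract (Poly_Mapping.single 0 c) 1"

definition Var :: "nat \<Rightarrow> 'a::field ratfun" where
  "Var i = Fraction_Field.Fract (Poly_Mapping.single (Poly_Mapping.single i 1) 1) 1"

definition is_subfield :: "'k::field set \<Rightarrow> bool" where
  "is_subfield L \<longleftrightarrow> 0 \<in> L \<and> 1 \<in> L \<and>
     (\<forall>x\<in>L. \<forall>y\<in>L. x + y \<in> L \<and> x * y \<in> L) \<and>
     (\<forall>x\<in>L. - x \<in> L \<and> inverse x \<in> L)"

definition adjoin :: "'a::field ratfun set \<Rightarrow> 'a ratfun set" where
  "adjoin A = \<Inter>{L. is_subfield L \<and> range Const \<subseteq> L \<and> A \<subseteq> L}"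

definition mpol_eval :: "(nat \<Rightarrow> 'a::field ratfun) \<Rightarrow> 'a mpol \<Rightarrow> 'a ratfun" where
  "mpol_eval g p = (\<Sum>m\<in>Poly_Mapping.keys p. Const (Poly_Mapping.lookup p m) *
     (\<Prod>i\<in>Poly_Mapping.keys m. g i ^ Poly_Mapping.lookup m i))"

text \<open>
  The substitution \<open>f(g 0, g 1, \<dots>)\<close>, meaningful as soon as \<open>f\<close> has a representation \<open>p / r\<close> whose
  denominator does not vanish at \<open>g\<close>; the value does not depend on that representation.
\<close>

definition ratfun_subst :: "(nat \<Rightarrow> 'a::field ratfun) \<Rightarrow> 'a ratfun \<Rightarrow> 'a ratfun" where
  "ratfun_subst g f = (THE h. \<exists>p r. mpol_eval g r \<noteq> 0 \<and> f = Fraction_Field.Fract p r \<and> h = mpol_eval g p / mpol_eval g r)"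

definition Var_vec :: "nat \<Rightarrow> 'a::field ratfun vec" where
  "Var_vec n = vec n Var"

text \<open>
  \<open>Var j\<close> is sent to the \<open>j\<close>-th entry of the row vector \<open>(Var 0, \<dots>, Var (n - 1)) T\<close>; the variables with
  index at least \<open>n\<close>, which do not occur in the rational functions in \<open>n\<close> variables, are left alone.
\<close>

definition sigma :: "nat \<Rightarrow> 'a::field mat \<Rightarrow> 'a ratfun \<Rightarrow> 'a ratfun" where
  "sigma n T = ratfun_subst (\<lambda>j. if j < n then Var_vec n \<bullet> col (map_mat Const T) j else Var j)"

definition fixed_field :: "nat \<Rightarrow> 'a::field mat set \<Rightarrow> 'a ratfun set" where
  "fixed_field n H = {f \<in> adjoin (Var ` {..<n}). \<forall>T\<in>H. sigma n T f = f}"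

definition S_mat :: "nat \<Rightarrow> 'a::field mat" where
  "S_mat \<nu> = four_block_mat
     (four_block_mat (0\<^sub>m \<nu> \<nu>) (1\<^sub>m \<nu>) (1\<^sub>m \<nu>) (0\<^sub>m \<nu> \<nu>)) (0\<^sub>m (2 * \<nu>) 2)
     (0\<^sub>m 2 (2 * \<nu>)) (mat_of_rows_list 2 [[0, 1], [1, 1]])"

definition GL :: "nat \<Rightarrow> 'a::field mat set" where
  "GL n = {T \<in> carrier_mat n n. invertible_mat T}"

definition Ps :: "nat \<Rightarrow> 'a::field mat \<Rightarrow> 'a mat set" where
  "Ps n S = {T \<in> GL n. T * S * transpose_mat T = S}"

definition P_form :: "nat \<Rightarrow> 'a::{field,finite} mat \<Rightarrow> nat \<Rightarrow> 'a ratfun" where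
  "P_form n S k = Var_vec n \<bullet> (map_mat Const S *\<^sub>v vec n (\<lambda>i. Var i ^ (CARD('a) ^ k)))"

end

theory Submission
  imports Defs "Jordan_Normal_Form.Determinant"
begin

text \<open>
  Write \<open>q\<close> for the order of the finite field, \<open>X\<close> for the row vector of the variables, \<open>X^(q^k)\<close> for the
  vector of their \<open>q^k\<close>-th powers, \<open>B\<close> for the bilinear form with matrix \<open>S\<close>, and \<open>L\<close> for the field
  generated by the constants, the \<open>P_form n S k = B(X, X^(q^k))\<close> with \<open>1 \<le> k \<le> n - 1\<close>, and the last variable.

  The generators are invariant: a matrix \<open>T\<close> with \<open>T S T\<^sup>t = S\<close> acts in the same way on \<open>X\<close> and on
  \<open>X^(q^k)\<close>, so it preserves \<open>B(X, X^(q^k))\<close> (\<open>sigma_P_form\<close>). For \<open>k = 0\<close> the form is the square of the last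
  variable, in characteristic two, so the last variable is preserved as well (\<open>Ps_fixes_last_Var\<close>).

  Conversely, \<open>L\<close> contains the invariants of the whole general linear group. The additive polynomial
  \<open>T^(q^n) - \<Sum>i<n. c i * T^(q^i)\<close> that vanishes exactly on the span of the variables gives
  \<open>X^(q^n) = \<Sum>i<n. c i * X^(q^i)\<close>. Pairing this relation with \<open>X^(q^j)\<close> for \<open>1 \<le> j < n\<close> gives \<open>n - 1\<close> linear
  equations for \<open>c\<close> whose coefficients are powers of the \<open>P_form n S k\<close>; its last coordinate gives one
  more. All these coefficients lie in \<open>L\<close>, the system is nondegenerate (\<open>gram_nondegenerate\<close>), and
  Cramer's rule puts the \<open>c i\<close> into \<open>L\<close>. By Dickson's theorem (\<open>GL_invariants\<close>) they generate all
  invariants of the general linear group.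

  Finally, the stabilizer of \<open>P_form n S 1\<close> in the general linear group is precisely the
  pseudo-symplectic group (\<open>P_form_1_inj\<close>). Lagrange's theorem on rational functions
  (\<open>invariant_in_field_of_orbit_point\<close>) then expresses every pseudo-symplectic invariant as a polynomial in
  \<open>P_form n S 1\<close> over the invariants of the general linear group, hence as an element of \<open>L\<close>.

  The Galois theory behind Dickson's theorem is reduced to counting roots (\<open>ring_adjoin_descent\<close>) and
  that behind the last step to the uniqueness of interpolation polynomials.
\<close>

section \<open>Substitution homomorphisms\<close>

definition emb :: "'a::field mpol \<Rightarrow> 'a ratfun" where
  "emb p = Fraction_Field.Fract p 1"

lemma emb_hom: "comm_ring_hom emb"
  by unfold_locales (simp_all add: emb_def Zero_fract_def One_fract_def)

interpretation emb: comm_ring_hom emb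
  by (rule emb_hom)

lemma emb_eq_iff [simp]: "emb p = emb r \<longleftrightarrow> p = r"
  by (simp add: emb_def eq_fract)

lemma emb_eq_0_iff [simp]: "emb p = 0 \<longleftrightarrow> p = 0"
  using emb_eq_iff[of p 0] by (simp del: emb_eq_iff)

lemma Const_eq_emb: "Const c = emb (Poly_Mapping.single 0 c)"
  by (simp add: Const_def emb_def)

lemma Var_eq_emb: "Var i = emb (Poly_Mapping.single (Poly_Mapping.single i 1) 1)"
  by (simp add: Var_def emb_def)

lemma Fract_emb: "r \<noteq> 0 \<Longrightarrow> Fraction_Field.Fract p r = emb p / emb r"
  by (simp add: emb_def)

lemma ratfun_cases:
  obtains p r :: "'a::field mpol" where "r \<noteq> 0" "f = emb p / emb r"
proof (cases f rule: Fract_cases_nonzero)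
  case (Fract p r)
  then show ?thesis using that Fract_emb by metis
next
  case 0
  then show ?thesis using that[of 1 0] by simp
qed

definition mono_eval :: "(nat \<Rightarrow> 'a::field ratfun) \<Rightarrow> (nat \<Rightarrow>\<^sub>0 nat) \<Rightarrow> 'a ratfun" where
  "mono_eval g m = (\<Prod>i\<in>Poly_Mapping.keys m. g i ^ Poly_Mapping.lookup m i)"

lemma mono_eval_superset:
  assumes "finite J" "Poly_Mapping.keys m \<subseteq> J"
  shows "mono_eval g m = (\<Prod>i\<in>J. g i ^ Poly_Mapping.lookup m i)"
  unfolding mono_eval_def by (rule prod.mono_neutral_left) (use assms in \<open>auto simp: in_keys_iff\<close>)

lemma mono_eval_add: "mono_eval g (m + m') = mono_eval g m * mono_eval g m'"
proof -
  let ?J = "Poly_Mapping.keys m \<union> Poly_Mapping.keys m'"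
  have "Poly_Mapping.keys (m + m') \<subseteq> ?J"
    by (rule keys_add)
  then show ?thesis
    by (simp add: mono_eval_superset[of ?J] lookup_add power_add prod.distrib)
qed

lemma mono_eval_0 [simp]: "mono_eval g 0 = 1"
  by (simp add: mono_eval_def)

lemma mono_eval_single [simp]: "mono_eval g (Poly_Mapping.single i k) = g i ^ k"
  by (simp add: mono_eval_def)

lemma Const_add: "Const (a + b) = Const a + Const b"
  by (simp add: Const_def single_add)

lemma Const_mult: "Const (a * b) = Const a * Const b"
  by (simp add: Const_def mult_single)

lemma Const_0 [simp]: "Const 0 = 0"
  by (simp add: Const_def Zero_fract_def)

lemma Const_1 [simp]: "Const 1 = 1"
  by (simp add: Const_def One_fract_def)

lemma Const_field_hom: "field_hom Const"
  by unfold_locales (simp_all add: Const_add Const_mult)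

interpretation Const: field_hom Const
  by (rule Const_field_hom)

lemma mpol_eval_superset:
  assumes "finite J" "Poly_Mapping.keys p \<subseteq> J"
  shows "mpol_eval g p = (\<Sum>m\<in>J. Const (Poly_Mapping.lookup p m) * mono_eval g m)"
  unfolding mpol_eval_def mono_eval_def
  by (rule sum.mono_neutral_left) (use assms in \<open>auto simp: in_keys_iff\<close>)

lemma mpol_eval_add: "mpol_eval g (p + r) = mpol_eval g p + mpol_eval g r"
proof -
  let ?J = "Poly_Mapping.keys p \<union> Poly_Mapping.keys r"
  have "Poly_Mapping.keys (p + r) \<subseteq> ?J"
    by (rule keys_add)
  then show ?thesis
    by (simp add: mpol_eval_superset[of ?J] lookup_add Const_add algebra_simps sum.distrib)
qed

lemma mpol_eval_single: "mpol_eval g (Poly_Mapping.single m c) = Const c * mono_eval g m"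
  by (simp add: mpol_eval_superset[of "{m}"])

lemma mpol_eval_0 [simp]: "mpol_eval g 0 = 0"
  by (simp add: mpol_eval_def)

lemma mpol_sum_monomials:
  "p = (\<Sum>m\<in>Poly_Mapping.keys p. Poly_Mapping.single m (Poly_Mapping.lookup p m))"
  by (rule poly_mapping_eqI)
    (auto simp: lookup_sum lookup_single when_def in_keys_iff sum.delta)

lemma mpol_induct [case_names zero add single]:
  assumes "P 0" "\<And>p r. P p \<Longrightarrow> P r \<Longrightarrow> P (p + r)" "\<And>m c. P (Poly_Mapping.single m c)"
  shows "P (p :: 'a::field mpol)"
proof -
  have "P (\<Sum>m\<in>J. Poly_Mapping.single m (f m))" if "finite J" for J and f :: "_ \<Rightarrow> 'a"
    using that by induction (auto intro: assms)
  then show ?thesis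
    by (subst mpol_sum_monomials) simp
qed

lemma mpol_eval_mult: "mpol_eval g (p * r) = mpol_eval g p * mpol_eval g r"
proof (induction p rule: mpol_induct)
  case (single m c)
  show ?case
    by (induction r rule: mpol_induct)
      (simp_all add: mpol_eval_add mpol_eval_single mult_single mono_eval_add Const_mult algebra_simps)
qed (simp_all add: mpol_eval_add algebra_simps)

lemma mpol_eval_1 [simp]: "mpol_eval g 1 = 1"
  using mpol_eval_single[of g 0 1] by simp

lemma mpol_eval_hom: "comm_ring_hom (mpol_eval g)"
  by unfold_locales (simp_all add: mpol_eval_add mpol_eval_mult)

lemma single_variable_power:
  "Poly_Mapping.single (Poly_Mapping.single i (1::nat)) (1::'a::comm_semiring_1) ^ k =
    Poly_Mapping.single (Poly_Mapping.single i k) 1"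
  by (induction k) (simp_all add: mult_single flip: single_add)

lemma mono_eval_Var: "mono_eval Var m = emb (Poly_Mapping.single m 1)"
proof -
  have "(\<Prod>i\<in>J. Poly_Mapping.single (Poly_Mapping.single i (f i)) (1::'a)) =
      Poly_Mapping.single (\<Sum>i\<in>J. Poly_Mapping.single i (f i)) 1" if "finite J" for J f
    using that by induction (auto simp: mult_single)
  moreover have "m = (\<Sum>i\<in>Poly_Mapping.keys m. Poly_Mapping.single i (Poly_Mapping.lookup m i))"
    by (rule poly_mapping_eqI)
      (auto simp: lookup_sum lookup_single when_def in_keys_iff sum.delta)
  ultimately have "(\<Prod>i\<in>Poly_Mapping.keys m. Poly_Mapping.single
      (Poly_Mapping.single i (Poly_Mapping.lookup m i)) (1::'a)) = Poly_Mapping.single m 1"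
    by (metis finite_keys)
  then show ?thesis
    by (simp add: mono_eval_def Var_eq_emb single_variable_power[unfolded One_nat_def] flip: emb.hom_power emb.hom_prod)
qed

lemma mpol_eval_Var: "mpol_eval Var p = emb p"
proof (induction p rule: mpol_induct)
  case (single m c)
  show ?case
    by (simp add: mpol_eval_single mono_eval_Var Const_eq_emb mult_single flip: emb.hom_mult)
qed (simp_all add: mpol_eval_add emb.hom_add)

lemma hom_mpol_eval:
  assumes "comm_ring_hom h" "\<And>c. h (Const c) = Const c"
  shows "h (mpol_eval g p) = mpol_eval (\<lambda>i. h (g i)) p"
proof -
  interpret h: comm_ring_hom h by fact
  show ?thesis
    by (simp add: mpol_eval_def h.hom_sum h.hom_mult h.hom_prod h.hom_power assms(2))
qed

text \<open>A homomorphism that fixes the constants commutes with evaluation, and every rational function is a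
quotient of two polynomials evaluated at the variables.\<close>
lemma ratfun_hom_eqI:
  assumes "field_hom h" "field_hom h'"
    and "\<And>c. h (Const c) = Const c" "\<And>c. h' (Const c) = Const c" "\<And>i. h (Var i) = h' (Var i)"
  shows "h (f :: 'a::field ratfun) = h' f"
proof -
  interpret h: field_hom h by fact
  interpret h': field_hom h' by fact
  have "h (emb p) = h' (emb p)" for p
    using hom_mpol_eval[of h Var p] hom_mpol_eval[of h' Var p] assms(3-5)
      h.comm_ring_hom_axioms h'.comm_ring_hom_axioms
    by (simp add: mpol_eval_Var)
  then show ?thesis
    by (cases f rule: ratfun_cases) (simp add: h.hom_div h'.hom_div)
qed

text \<open>If the substitution annihilates no nonzero polynomial, every fraction may be used to compute it:
cross-multiplied equalities of polynomials are preserved by evaluation.\<close>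
lemma ratfun_subst_eq:
  assumes "\<And>r. r \<noteq> 0 \<Longrightarrow> mpol_eval g r \<noteq> 0" "r \<noteq> 0"
  shows "ratfun_subst g (emb p / emb r) = mpol_eval g p / mpol_eval g r"
  unfolding ratfun_subst_def
proof (rule the_equality)
  show "\<exists>p' r'. mpol_eval g r' \<noteq> 0 \<and> emb p / emb r = Fraction_Field.Fract p' r' \<and>
      mpol_eval g p / mpol_eval g r = mpol_eval g p' / mpol_eval g r'"
    using assms by (intro exI[of _ p] exI[of _ r]) (simp add: Fract_emb)
next
  fix h
  assume "\<exists>p' r'. mpol_eval g r' \<noteq> 0 \<and> emb p / emb r = Fraction_Field.Fract p' r' \<and>
      h = mpol_eval g p' / mpol_eval g r'"
  then obtain p' r' where *: "mpol_eval g r' \<noteq> 0" "emb p / emb r = Fraction_Field.Fract p' r'"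
      "h = mpol_eval g p' / mpol_eval g r'"
    by blast
  from * have "r' \<noteq> 0" by auto
  with * assms(2) have "p * r' = p' * r"
    by (simp add: emb_def eq_fract)
  then have "mpol_eval g p * mpol_eval g r' = mpol_eval g p' * mpol_eval g r"
    by (simp flip: mpol_eval_mult)
  then show "h = mpol_eval g p / mpol_eval g r"
    using * assms by (simp add: frac_eq_eq)
qed

lemma ratfun_subst_hom:
  assumes "\<And>r. r \<noteq> 0 \<Longrightarrow> mpol_eval g r \<noteq> 0"
  shows "field_hom (ratfun_subst g)"
    and "ratfun_subst g (Const (c :: 'a::field)) = Const c"
    and "ratfun_subst g (Var i) = g i"
proof -
  have emb: "ratfun_subst g (emb p) = mpol_eval g p" for p
    using ratfun_subst_eq[OF assms, of 1 p] by simp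
  show "ratfun_subst g (Const c) = Const c" "ratfun_subst g (Var i) = g i"
    using emb[of "Poly_Mapping.single 0 c"] emb[of "Poly_Mapping.single (Poly_Mapping.single i 1) 1"]
    by (simp_all add: Const_eq_emb[symmetric] Var_eq_emb[symmetric] mpol_eval_single
        del: One_nat_def)
  show "field_hom (ratfun_subst g)"
  proof unfold_locales
    fix x y :: "'a ratfun"
    obtain p r where x: "r \<noteq> 0" "x = emb p / emb r" by (rule ratfun_cases)
    obtain p' r' where y: "r' \<noteq> 0" "y = emb p' / emb r'" by (rule ratfun_cases)
    interpret ev: comm_ring_hom "mpol_eval g" by (rule mpol_eval_hom)
    have "x * y = emb (p * p') / emb (r * r')" "x + y = emb (p * r' + p' * r) / emb (r * r')"
      using x y by (simp_all add: emb.hom_mult emb.hom_add add_frac_eq)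
    then show "ratfun_subst g (x * y) = ratfun_subst g x * ratfun_subst g y"
      "ratfun_subst g (x + y) = ratfun_subst g x + ratfun_subst g y"
      using x y by (simp_all only: ratfun_subst_eq[OF assms] no_zero_divisors not_False_eq_True)
        (simp_all add: ev.hom_mult ev.hom_add assms field_simps)
  qed (use emb[of 0] emb[of 1] in simp_all)
qed

text \<open>Composing two substitutions whose inner one has polynomial values is again a substitution. This is
used to invert a linear substitution, and thereby to see that it annihilates no nonzero
polynomial.\<close>
lemma mpol_eval_comp:
  assumes "\<And>j. g j = emb (\<gamma> j)"
  obtains s where "mpol_eval g r = emb s"
    and "\<And>g'. mpol_eval g' s = mpol_eval (\<lambda>j. mpol_eval g' (\<gamma> j)) r"
proof -
  define s where "s = (\<Sum>m\<in>Poly_Mapping.keys r. Poly_Mapping.single 0 (Poly_Mapping.lookup r m) *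
     (\<Prod>i\<in>Poly_Mapping.keys m. \<gamma> i ^ Poly_Mapping.lookup m i))"
  have *: "mpol_eval g' s = mpol_eval (\<lambda>j. mpol_eval g' (\<gamma> j)) r" for g'
  proof -
    interpret ev: comm_ring_hom "mpol_eval g'" by (rule mpol_eval_hom)
    show ?thesis
      unfolding s_def by (simp add: ev.hom_sum ev.hom_mult ev.hom_prod ev.hom_power mpol_eval_single)
        (simp add: mpol_eval_def)
  qed
  from *[of Var] have "mpol_eval g r = emb s"
    by (simp add: mpol_eval_Var assms[abs_def])
  with * show thesis by (rule that[rotated])
qed

section \<open>The action of the general linear group\<close>

definition lin_subst :: "nat \<Rightarrow> 'a::field mat \<Rightarrow> nat \<Rightarrow> 'a ratfun" where
  "lin_subst n T j = (if j < n then \<Sum>k<n. Const (T $$ (k, j)) * Var k else Var j)"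

lemma sigma_eq_subst:
  assumes "T \<in> carrier_mat n n"
  shows "sigma n T = ratfun_subst (lin_subst n T)"
proof -
  have "(\<lambda>j. if j < n then Var_vec n \<bullet> col (map_mat Const T) j else Var j) = lin_subst n T"
    using assms by (auto simp: fun_eq_iff lin_subst_def Var_vec_def scalar_prod_def mult.commute
        atLeast0LessThan intro!: sum.cong)
  then show ?thesis by (simp add: sigma_def)
qed

lemma sum_delta_mult:
  assumes "j < (n::nat)"
  shows "(\<Sum>k<n. (if k = j then 1 else 0) * f k) = (f j :: 'b::comm_semiring_1)"
proof -
  have "(\<Sum>k<n. (if k = j then 1 else 0) * f k) = (\<Sum>k<n. if k = j then f k else 0)"
    by (rule sum.cong) auto
  also have "\<dots> = f j" using assms by (subst sum.delta) auto
  finally show ?thesis .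
qed

lemma mat_mult_entry:
  assumes "A \<in> carrier_mat n n" "B \<in> carrier_mat n n" "i < n" "j < n"
  shows "(A * B) $$ (i, j) = (\<Sum>k<n. A $$ (i, k) * B $$ (k, j))"
  using assms by (auto simp: scalar_prod_def atLeast0LessThan intro!: sum.cong)

text \<open>Substituting row vector times \<open>A\<close> into row vector times \<open>B\<close> yields row vector times \<open>A B\<close>, so the
action is a left action: the matrix that is applied last stands on the left.\<close>
lemma lin_subst_compose:
  assumes "A \<in> carrier_mat n n" "B \<in> carrier_mat n n" "j < n"
  shows "(\<Sum>k<n. Const (B $$ (k, j)) * lin_subst n A k) = lin_subst n (A * B) j"
proof -
  have "(\<Sum>k<n. Const (B $$ (k, j)) * lin_subst n A k) =
      (\<Sum>k<n. \<Sum>l<n. Const (B $$ (k, j)) * (Const (A $$ (l, k)) * Var l))"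
    by (simp add: lin_subst_def sum_distrib_left)
  also have "\<dots> = (\<Sum>l<n. \<Sum>k<n. Const (B $$ (k, j)) * (Const (A $$ (l, k)) * Var l))"
    by (rule sum.swap)
  also have "\<dots> = (\<Sum>l<n. Const ((A * B) $$ (l, j)) * Var l)"
  proof (rule sum.cong[OF refl])
    fix l assume "l \<in> {..<n}"
    then have "(A * B) $$ (l, j) = (\<Sum>k<n. A $$ (l, k) * B $$ (k, j))"
      using assms by (intro mat_mult_entry) auto
    then show "(\<Sum>k<n. Const (B $$ (k, j)) * (Const (A $$ (l, k)) * Var l)) =
        Const ((A * B) $$ (l, j)) * Var l"
      by (simp only: Const.hom_sum Const_mult sum_distrib_right) (simp add: mult_ac)
  qed
  finally show ?thesis using assms by (simp add: lin_subst_def)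
qed

lemma lin_subst_one: "lin_subst n (1\<^sub>m n) j = Var j"
proof (cases "j < n")
  case True
  then have "lin_subst n (1\<^sub>m n) j = (\<Sum>k<n. (if k = j then 1 else 0) * Var k)"
    by (auto simp: lin_subst_def intro!: sum.cong)
  then show ?thesis using sum_delta_mult[OF True] by (rule trans)
qed (simp add: lin_subst_def)

lemma GL_inverse:
  assumes "T \<in> GL n"
  obtains T' where "T' \<in> GL n" "T * T' = 1\<^sub>m n" "T' * T = 1\<^sub>m n"
proof -
  have T: "T \<in> carrier_mat n n" using assms by (simp add: GL_def)
  from assms obtain B where B: "T * B = 1\<^sub>m n" "B * T = 1\<^sub>m (dim_row B)"
    by (auto simp: GL_def invertible_mat_def inverts_mat_def)
  have "dim_col B = n" using B(1) by (metis index_mult_mat(3) index_one_mat(3))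
  moreover have "dim_row B = n" using B(2) T by (metis carrier_matD(2) index_mult_mat(3) index_one_mat(3))
  ultimately have "B \<in> carrier_mat n n" by auto
  with T B show thesis
    by (intro that[of B]) (auto simp: GL_def invertible_mat_def inverts_mat_def)
qed

lemma GL_mult: "A \<in> GL n \<Longrightarrow> B \<in> GL n \<Longrightarrow> A * B \<in> GL n"
proof -
  assume *: "A \<in> GL n" "B \<in> GL n"
  obtain A' where A': "A' \<in> GL n" "A * A' = 1\<^sub>m n" "A' * A = 1\<^sub>m n" using *(1) by (rule GL_inverse)
  obtain B' where B': "B' \<in> GL n" "B * B' = 1\<^sub>m n" "B' * B = 1\<^sub>m n" using *(2) by (rule GL_inverse)
  have c: "A \<in> carrier_mat n n" "B \<in> carrier_mat n n" "A' \<in> carrier_mat n n" "B' \<in> carrier_mat n n"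
    using * A' B' by (auto simp: GL_def)
  have "(A * B) * (B' * A') = A * ((B * B') * A')"
    using c by (simp add: assoc_mult_mat[of _ n n _ n _ n])
  moreover have "(B' * A') * (A * B) = B' * ((A' * A) * B)"
    using c by (simp add: assoc_mult_mat[of _ n n _ n _ n])
  ultimately show ?thesis
    using c A' B' unfolding GL_def invertible_mat_def inverts_mat_def by auto
qed

lemma one_in_GL: "1\<^sub>m n \<in> GL n"
  by (auto simp: GL_def invertible_mat_def inverts_mat_def intro!: exI[of _ "1\<^sub>m n"])

text \<open>Substituting with the inverse matrix afterwards recovers the polynomial, so it was not lost.\<close>
lemma mpol_eval_lin_subst_nonzero:
  assumes "T \<in> GL n" "r \<noteq> 0"
  shows "mpol_eval (lin_subst n T) r \<noteq> 0"
proof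
  assume 0: "mpol_eval (lin_subst n T) r = 0"
  obtain T' where T': "T' \<in> GL n" "T' * T = 1\<^sub>m n" using assms(1) by (metis GL_inverse)
  have "\<exists>s. lin_subst n T j = emb s" for j
  proof (cases "j < n")
    case True
    have "lin_subst n T j = emb (\<Sum>k<n. Poly_Mapping.single 0 (T $$ (k, j)) * Poly_Mapping.single (Poly_Mapping.single k 1) 1)"
      using True by (simp add: lin_subst_def emb.hom_sum emb.hom_mult Const_eq_emb Var_eq_emb)
    then show ?thesis by blast
  next
    case False
    then show ?thesis unfolding lin_subst_def Var_eq_emb by auto
  qed
  then obtain \<gamma> where \<gamma>: "\<And>j. lin_subst n T j = emb (\<gamma> j)" by metis
  obtain s where s: "mpol_eval (lin_subst n T) r = emb s"
      "\<And>g'. mpol_eval g' s = mpol_eval (\<lambda>j. mpol_eval g' (\<gamma> j)) r"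
    using mpol_eval_comp[of "lin_subst n T" \<gamma> r, OF \<gamma>] by blast
  from s(1) 0 have "s = 0" by simp
  have "mpol_eval (lin_subst n T') (\<gamma> j) = Var j" for j
  proof (cases "j < n")
    case True
    interpret ev: comm_ring_hom "mpol_eval (lin_subst n T')" by (rule mpol_eval_hom)
    have "\<gamma> j = (\<Sum>k<n. Poly_Mapping.single 0 (T $$ (k, j)) * Poly_Mapping.single (Poly_Mapping.single k 1) 1)"
    proof -
      have "emb (\<gamma> j) = emb (\<Sum>k<n. Poly_Mapping.single 0 (T $$ (k, j)) * Poly_Mapping.single (Poly_Mapping.single k 1) 1)"
        using True by (simp add: \<gamma>[symmetric] lin_subst_def emb.hom_sum emb.hom_mult Const_eq_emb Var_eq_emb)
      then show ?thesis by simp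
    qed
    then have "mpol_eval (lin_subst n T') (\<gamma> j) = (\<Sum>k<n. Const (T $$ (k, j)) * lin_subst n T' k)"
      by (simp add: ev.hom_sum ev.hom_mult mpol_eval_single)
    also have "\<dots> = lin_subst n (T' * T) j"
      using assms(1) T'(1) True by (intro lin_subst_compose) (auto simp: GL_def)
    finally show ?thesis by (simp add: T' lin_subst_one)
  next
    case False
    then have "emb (\<gamma> j) = Var j" using \<gamma>[of j] by (simp add: lin_subst_def)
    then have "\<gamma> j = Poly_Mapping.single (Poly_Mapping.single j 1) 1"
      by (simp add: Var_eq_emb)
    with False show ?thesis by (simp add: mpol_eval_single lin_subst_def)
  qed
  then have "mpol_eval (lin_subst n T') s = emb r"
    by (simp add: s(2) mpol_eval_Var)
  with \<open>s = 0\<close> assms(2) show False by simp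
qed

lemma sigma_hom:
  assumes "T \<in> GL n"
  shows "field_hom (sigma n T)" "sigma n T (Const c) = Const c" "sigma n T (Var j) = lin_subst n T j"
proof -
  have "T \<in> carrier_mat n n" using assms by (simp add: GL_def)
  then show "field_hom (sigma n T)" "sigma n T (Const c) = Const c" "sigma n T (Var j) = lin_subst n T j"
    using ratfun_subst_hom[of "lin_subst n T"] mpol_eval_lin_subst_nonzero[OF assms]
    by (simp_all add: sigma_eq_subst)
qed

lemma sigma_mult:
  assumes "A \<in> GL n" "B \<in> GL n"
  shows "sigma n (A * B) f = sigma n A (sigma n B f)"
proof -
  interpret A: field_hom "sigma n A" by (rule sigma_hom) fact
  interpret B: field_hom "sigma n B" by (rule sigma_hom) fact
  have hom: "field_hom (\<lambda>f. sigma n A (sigma n B f))"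
    by unfold_locales (simp_all add: A.hom_add B.hom_add A.hom_mult B.hom_mult)
  show ?thesis
  proof (rule ratfun_hom_eqI[OF sigma_hom(1)[OF GL_mult[OF assms]] hom])
    fix i
    show "sigma n (A * B) (Var i) = sigma n A (sigma n B (Var i))"
    proof (cases "i < n")
      case True
      have "sigma n A (lin_subst n B i) = (\<Sum>k<n. Const (B $$ (k, i)) * lin_subst n A k)"
        using True assms by (simp add: lin_subst_def[of n B] A.hom_sum A.hom_mult sigma_hom)
      also have "\<dots> = lin_subst n (A * B) i"
        using assms True by (intro lin_subst_compose) (auto simp: GL_def)
      finally have "sigma n A (lin_subst n B i) = lin_subst n (A * B) i" .
      with assms show ?thesis by (simp add: sigma_hom GL_mult)
    next
      case False
      with assms show ?thesis by (simp add: sigma_hom GL_mult lin_subst_def)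
    qed
  qed (use assms in \<open>simp_all add: sigma_hom GL_mult\<close>)
qed

lemma sigma_one: "sigma n (1\<^sub>m n) f = f"
proof -
  have "field_hom (\<lambda>x :: 'a ratfun. x)" by unfold_locales auto
  from ratfun_hom_eqI[OF sigma_hom(1)[OF one_in_GL] this] show ?thesis
    by (simp add: sigma_hom one_in_GL lin_subst_one)
qed

lemma finite_GL: "finite (GL n :: 'a::{field,finite} mat set)"
proof -
  let ?F = "{..<n} \<times> {..<n} \<rightarrow>\<^sub>E (UNIV :: 'a set)"
  have "GL n \<subseteq> (\<lambda>f. mat n n f) ` ?F"
  proof
    fix T :: "'a mat" assume "T \<in> GL n"
    then have "T \<in> carrier_mat n n" by (simp add: GL_def)
    then have "T = mat n n (restrict (\<lambda>ij. T $$ ij) ({..<n} \<times> {..<n}))"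
      by (intro eq_matI) auto
    then show "T \<in> (\<lambda>f. mat n n f) ` ?F" by (rule image_eqI[of _ _ "restrict (\<lambda>ij. T $$ ij) ({..<n} \<times> {..<n})"]) auto
  qed
  moreover have "finite ?F" by (intro finite_PiE) auto
  ultimately show ?thesis by (rule finite_subset[OF _ finite_imageI])
qed

section \<open>Subrings, subfields and polynomials over them\<close>

definition is_subring :: "'k::comm_ring_1 set \<Rightarrow> bool" where
  "is_subring R \<longleftrightarrow> 0 \<in> R \<and> 1 \<in> R \<and> (\<forall>x\<in>R. - x \<in> R) \<and> (\<forall>x\<in>R. \<forall>y\<in>R. x + y \<in> R \<and> x * y \<in> R)"

definition poly_over :: "'k::comm_ring_1 set \<Rightarrow> 'k poly \<Rightarrow> bool" where
  "poly_over R p \<longleftrightarrow> (\<forall>k. poly.coeff p k \<in> R)"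

lemma subringD:
  assumes "is_subring R"
  shows subring_0: "0 \<in> R" and subring_1: "1 \<in> R"
    and subring_uminus: "x \<in> R \<Longrightarrow> - x \<in> R"
    and subring_add: "x \<in> R \<Longrightarrow> y \<in> R \<Longrightarrow> x + y \<in> R"
    and subring_mult: "x \<in> R \<Longrightarrow> y \<in> R \<Longrightarrow> x * y \<in> R"
    and subring_diff: "x \<in> R \<Longrightarrow> y \<in> R \<Longrightarrow> x - y \<in> R"
  using assms unfolding is_subring_def by (auto simp: diff_conv_add_uminus simp del: add_uminus_conv_diff)

lemma subring_sum: "is_subring R \<Longrightarrow> (\<And>i. i \<in> I \<Longrightarrow> f i \<in> R) \<Longrightarrow> sum f I \<in> R"
  by (induction I rule: infinite_finite_induct) (auto intro: subringD)

lemma subring_prod: "is_subring R \<Longrightarrow> (\<And>i. i \<in> I \<Longrightarrow> f i \<in> R) \<Longrightarrow> prod f I \<in> R"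
  by (induction I rule: infinite_finite_induct) (auto intro: subringD)

lemma subring_power: "is_subring R \<Longrightarrow> x \<in> R \<Longrightarrow> x ^ k \<in> R"
  by (induction k) (auto intro: subringD)

lemma subfield_imp_subring: "is_subfield L \<Longrightarrow> is_subring L"
  by (auto simp: is_subfield_def is_subring_def)

lemma subfield_divide: "is_subfield L \<Longrightarrow> x \<in> L \<Longrightarrow> y \<in> L \<Longrightarrow> x / y \<in> L"
  by (auto simp: is_subfield_def divide_inverse)

lemma poly_over_pCons: "poly_over R (pCons a p) \<longleftrightarrow> a \<in> R \<and> poly_over R p"
  by (auto simp: poly_over_def coeff_pCons split: nat.splits)

lemma poly_over_0: "is_subring R \<Longrightarrow> poly_over R 0"
  by (simp add: poly_over_def subring_0)

lemma poly_over_1: "is_subring R \<Longrightarrow> poly_over R 1"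
  by (auto simp: poly_over_pCons poly_over_0 subring_1 one_pCons)

lemma poly_over_add: "is_subring R \<Longrightarrow> poly_over R p \<Longrightarrow> poly_over R q \<Longrightarrow> poly_over R (p + q)"
  by (simp add: poly_over_def subring_add)

lemma poly_over_uminus: "is_subring R \<Longrightarrow> poly_over R p \<Longrightarrow> poly_over R (- p)"
  by (simp add: poly_over_def subring_uminus)

lemma poly_over_diff: "is_subring R \<Longrightarrow> poly_over R p \<Longrightarrow> poly_over R q \<Longrightarrow> poly_over R (p - q)"
  by (simp add: poly_over_def subring_diff)

lemma poly_over_mult: "is_subring R \<Longrightarrow> poly_over R p \<Longrightarrow> poly_over R q \<Longrightarrow> poly_over R (p * q)"
  by (auto simp: poly_over_def coeff_mult intro!: subring_sum subring_mult)

lemma poly_over_smult: "is_subring R \<Longrightarrow> c \<in> R \<Longrightarrow> poly_over R p \<Longrightarrow> poly_over R (smult c p)"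
  by (simp add: poly_over_def subring_mult)

lemma poly_over_monom: "is_subring R \<Longrightarrow> c \<in> R \<Longrightarrow> poly_over R (monom c k)"
  by (simp add: poly_over_def subring_0)

lemma poly_over_sum: "is_subring R \<Longrightarrow> (\<And>i. i \<in> I \<Longrightarrow> poly_over R (f i)) \<Longrightarrow> poly_over R (sum f I)"
  by (induction I rule: infinite_finite_induct) (auto intro: poly_over_0 poly_over_add)

lemma poly_over_prod: "is_subring R \<Longrightarrow> (\<And>i. i \<in> I \<Longrightarrow> poly_over R (f i)) \<Longrightarrow> poly_over R (prod f I)"
  by (induction I rule: infinite_finite_induct) (auto intro: poly_over_1 poly_over_mult)

lemma poly_over_eval: "is_subring R \<Longrightarrow> poly_over R p \<Longrightarrow> x \<in> R \<Longrightarrow> poly p x \<in> R"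
  by (auto simp: poly_altdef poly_over_def intro!: subring_sum subring_mult subring_power)

text \<open>Division with remainder by a monic polynomial never divides by a coefficient, so it stays over any
subring that contains the coefficients.\<close>
lemma monic_division:
  fixes A B :: "'k::idom poly"
  assumes "is_subring R" "poly_over R B" "lead_coeff B = 1" "poly_over R A"
  shows "\<exists>Q S. poly_over R Q \<and> poly_over R S \<and> A = B * Q + S \<and> (S = 0 \<or> degree S < degree B)"
  using assms(4)
proof (induction "degree A" arbitrary: A rule: less_induct)
  case less
  show ?case
  proof (cases "degree A < degree B")
    case True
    then show ?thesis
      using less.prems assms(1) by (intro exI[of _ 0] exI[of _ A]) (auto simp: poly_over_0)
  next
    case False
    define M where "M = monom (lead_coeff A) (degree A - degree B)"
    define A' where "A' = A - B * M"
    have M: "poly_over R M"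
      using assms(1) less.prems unfolding M_def by (intro poly_over_monom) (auto simp: poly_over_def)
    have A': "poly_over R A'"
      unfolding A'_def using assms less.prems M by (intro poly_over_diff poly_over_mult) auto
    have "degree M \<le> degree A - degree B" unfolding M_def by (rule degree_monom_le)
    then have "degree (B * M) \<le> degree A"
      using degree_mult_le[of B M] False by linarith
    then have le: "degree A' \<le> degree A" unfolding A'_def by (intro degree_diff_le) auto
    have "poly.coeff (B * M) (degree A) = lead_coeff A"
      using False assms(3) by (simp add: M_def mult.commute[of B] coeff_monom_mult)
    then have top: "poly.coeff A' (degree A) = 0" by (simp add: A'_def)
    show ?thesis
    proof (cases "A' = 0")
      case True
      then show ?thesis
        using M assms(1) by (intro exI[of _ M] exI[of _ 0]) (auto simp: A'_def poly_over_0)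
    next
      case False
      with le top have "degree A' < degree A" by (metis le_neq_implies_less leading_coeff_0_iff)
      from less.hyps[OF this A'] obtain Q S where "poly_over R Q" "poly_over R S" "A' = B * Q + S"
          "S = 0 \<or> degree S < degree B" by blast
      then show ?thesis
        using M assms(1) by (intro exI[of _ "M + Q"] exI[of _ S])
          (auto simp: A'_def poly_over_add algebra_simps)
    qed
  qed
qed

lemma poly_over_monic_quotient:
  fixes B Q :: "'k::idom poly"
  assumes "is_subring R" "poly_over R B" "lead_coeff B = 1" "poly_over R (B * Q)"
  shows "poly_over R Q"
proof -
  obtain Q' S where *: "poly_over R Q'" "B * Q = B * Q' + S" "S = 0 \<or> degree S < degree B"
    using monic_division[OF assms] by blast
  have "B * (Q - Q') = S" using *(2) by (simp add: algebra_simps)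
  have "Q = Q'"
  proof (rule ccontr)
    assume "Q \<noteq> Q'"
    moreover have "B \<noteq> 0" using assms(3) by auto
    ultimately have "S \<noteq> 0" "degree S = degree B + degree (Q - Q')"
      using \<open>B * (Q - Q') = S\<close> by (auto simp: degree_mult_eq)
    with *(3) show False by simp
  qed
  with * show ?thesis by simp
qed

definition ring_adjoin :: "'k::comm_ring_1 set \<Rightarrow> 'k \<Rightarrow> 'k set" where
  "ring_adjoin R x = {poly r x | r. poly_over R r}"

lemma ring_adjoin_subring:
  assumes "is_subring R"
  shows "is_subring (ring_adjoin R x)"
  unfolding is_subring_def
proof (intro conjI ballI)
  fix a b assume "a \<in> ring_adjoin R x" "b \<in> ring_adjoin R x"
  then obtain p r where *: "poly_over R p" "poly_over R r" "a = poly p x" "b = poly r x"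
    by (auto simp: ring_adjoin_def)
  have "a + b = poly (p + r) x" "a * b = poly (p * r) x" using * by auto
  then show "a + b \<in> ring_adjoin R x" "a * b \<in> ring_adjoin R x"
    using * assms poly_over_add[of R p r] poly_over_mult[of R p r] unfolding ring_adjoin_def by blast+
next
  fix a assume "a \<in> ring_adjoin R x"
  then obtain p where *: "poly_over R p" "a = poly p x" by (auto simp: ring_adjoin_def)
  then have "- a = poly (- p) x" by simp
  with * assms poly_over_uminus[of R p] show "- a \<in> ring_adjoin R x"
    unfolding ring_adjoin_def by blast
next
  show "0 \<in> ring_adjoin R x" "1 \<in> ring_adjoin R x"
    using assms poly_over_0 poly_over_1 unfolding ring_adjoin_def by (metis (mono_tags, lifting) mem_Collect_eq poly_0 poly_1)+
qed

lemma ring_adjoin_base: "is_subring R \<Longrightarrow> a \<in> R \<Longrightarrow> a \<in> ring_adjoin R x"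
  unfolding ring_adjoin_def using poly_over_pCons[of R a 0] poly_over_0[of R]
  by (auto intro!: exI[of _ "[:a:]"])

lemma ring_adjoin_gen: "is_subring R \<Longrightarrow> x \<in> ring_adjoin R x"
  unfolding ring_adjoin_def
  by (auto intro!: exI[of _ "[:0, 1:]"] simp: poly_over_pCons poly_over_0 subring_0 subring_1)

text \<open>Reduce a polynomial expression of \<open>f\<close> in \<open>x\<close> modulo the monic polynomial \<open>D\<close>, obtaining
\<open>f = S(x)\<close> with \<open>degree S < degree D\<close>. Each homomorphism that fixes \<open>R\<close> and \<open>f\<close> and moves \<open>x\<close> to \<open>u\<close>
shows \<open>f = S(u)\<close>. There are more such values \<open>u\<close> than the degree of \<open>S\<close> permits unless \<open>S\<close> is the
constant \<open>f\<close>, whose coefficient lies in \<open>R\<close>. This replaces the Galois correspondence.\<close>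
lemma ring_adjoin_descent:
  fixes x :: "'k::field"
  assumes R: "is_subring R" and D: "poly_over R D" "lead_coeff D = 1" "poly D x = 0"
    and U: "card U = degree D"
    and hom: "\<And>u. u \<in> U \<Longrightarrow> \<exists>h. comm_ring_hom h \<and> (\<forall>a\<in>R. h a = a) \<and> h x = u \<and> h f = f"
    and f: "f \<in> ring_adjoin R x"
  shows "f \<in> R"
proof -
  obtain p where p: "poly_over R p" "f = poly p x" using f by (auto simp: ring_adjoin_def)
  obtain Q S where QS: "poly_over R S" "p = D * Q + S" "S = 0 \<or> degree S < degree D"
    using monic_division[OF R D(1,2) p(1)] by blast
  have fS: "f = poly S x" using p QS D(3) by simp
  have "degree D \<noteq> 0"
  proof
    assume "degree D = 0"
    with D(2) have "D = 1" by (metis degree_eq_zeroE lead_coeff_pCons(2) one_pCons)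
    with D(3) show False by simp
  qed
  have "S = [:f:]"
  proof (rule poly_eqI_degree[of U])
    fix u assume "u \<in> U"
    then obtain h where h: "comm_ring_hom h" "\<And>a. a \<in> R \<Longrightarrow> h a = a" "h x = u" "h f = f"
      using hom by blast
    interpret h: comm_ring_hom h by fact
    have "f = h (poly S x)" using fS h by simp
    also have "\<dots> = poly S u"
      using QS(1) h by (simp add: poly_altdef h.hom_sum h.hom_mult h.hom_power poly_over_def)
    finally show "poly S u = poly [:f:] u" by simp
  qed (use U QS(3) \<open>degree D \<noteq> 0\<close> in auto)
  then show ?thesis using QS(1) by (auto simp: poly_over_pCons)
qed

section \<open>Square linear systems\<close>

definition nondegenerate :: "nat \<Rightarrow> (nat \<Rightarrow> nat \<Rightarrow> 'k::field) \<Rightarrow> bool" where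
  "nondegenerate n A \<longleftrightarrow>
     (\<forall>x. (\<forall>i<n. (\<Sum>j<n. A i j * x j) = 0) \<longrightarrow> (\<forall>j<n. x j = 0))"

lemma mult_mat_vec_fun:
  "mat n n (\<lambda>(i, j). A i j) *\<^sub>v vec n x = vec n (\<lambda>i. \<Sum>j<n. A i j * x j)"
  by (intro eq_vecI) (auto simp: scalar_prod_def atLeast0LessThan intro!: sum.cong)

lemma nondegenerate_iff_det:
  "nondegenerate n A \<longleftrightarrow> det (mat n n (\<lambda>(i, j). A i j)) \<noteq> 0"
proof -
  let ?M = "mat n n (\<lambda>(i, j). A i j)"
  have M: "?M \<in> carrier_mat n n" by simp
  show ?thesis
  proof
    assume nd: "nondegenerate n A"
    show "det ?M \<noteq> 0"
    proof
      assume "det ?M = 0"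
      then obtain v where v: "v \<in> carrier_vec n" "v \<noteq> 0\<^sub>v n" "?M *\<^sub>v v = 0\<^sub>v n"
        using det_0_iff_vec_prod_zero_field[OF M] by blast
      have "vec n (\<lambda>i. v $ i) = v" using v(1) by auto
      then have "vec n (\<lambda>i. \<Sum>j<n. A i j * v $ j) = 0\<^sub>v n"
        using mult_mat_vec_fun[of n A "\<lambda>i. v $ i"] v(3) by simp
      then have comp: "vec n (\<lambda>i. \<Sum>j<n. A i j * v $ j) $ i = 0\<^sub>v n $ i" for i
        by (simp only:)
      have "(\<Sum>j<n. A i j * v $ j) = 0" if "i < n" for i
        using that comp[of i] by simp
      with nd have "\<forall>i<n. v $ i = 0"
        unfolding nondegenerate_def by blast
      with v(1) have "v = 0\<^sub>v n" by (intro eq_vecI) auto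
      with v(2) show False by simp
    qed
  next
    assume d: "det ?M \<noteq> 0"
    show "nondegenerate n A"
      unfolding nondegenerate_def
    proof (intro allI impI)
      fix x j assume x: "\<forall>i<n. (\<Sum>j<n. A i j * x j) = 0" and "j < n"
      have "?M *\<^sub>v vec n x = 0\<^sub>v n" using x by (subst mult_mat_vec_fun) (auto intro: eq_vecI)
      with d have "vec n x = 0\<^sub>v n" using det_0_iff_vec_prod_zero_field[OF M] vec_carrier by blast
      with \<open>j < n\<close> show "x j = 0" by (metis index_vec index_zero_vec(1))
    qed
  qed
qed

lemma nondegenerate_transpose:
  assumes "nondegenerate n A"
  shows "nondegenerate n (\<lambda>i j. A j i)"
proof -
  let ?M = "mat n n (\<lambda>(i, j). A i j)"
  have "transpose_mat ?M = mat n n (\<lambda>(i, j). A j i)"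
    by (intro eq_matI) auto
  moreover have "det (transpose_mat ?M) = det ?M" by (rule det_transpose[of _ n]) simp
  ultimately show ?thesis using assms by (simp add: nondegenerate_iff_det)
qed

lemma nondegenerate_solvable:
  assumes "nondegenerate n A"
  shows "\<exists>x. \<forall>i<n. (\<Sum>j<n. A i j * x j) = b i"
proof -
  let ?M = "mat n n (\<lambda>(i, j). A i j)"
  have M: "?M \<in> carrier_mat n n" by simp
  have "det ?M \<noteq> 0" using assms by (simp add: nondegenerate_iff_det)
  from det_non_zero_imp_unit[OF M this, of "()"]
  obtain B where B: "B \<in> carrier_mat n n" "?M * B = 1\<^sub>m n"
    unfolding Units_def ring_mat_def by auto
  define x where "x = B *\<^sub>v vec n b"
  have xc: "x \<in> carrier_vec n" unfolding x_def using B by auto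
  then have "vec n (\<lambda>i. x $ i) = x" by auto
  have "?M *\<^sub>v x = vec n b"
    unfolding x_def using B M by (simp flip: assoc_mult_mat_vec[of _ n n _ n])
  moreover have "?M *\<^sub>v x = vec n (\<lambda>i. \<Sum>j<n. A i j * x $ j)"
    using mult_mat_vec_fun[of n A "\<lambda>i. x $ i"] \<open>vec n (\<lambda>i. x $ i) = x\<close> by simp
  ultimately have comp: "vec n (\<lambda>i. \<Sum>j<n. A i j * x $ j) $ i = vec n b $ i" for i
    by simp
  have "(\<Sum>j<n. A i j * x $ j) = b i" if "i < n" for i
    using that comp[of i] by simp
  then have "\<forall>i<n. (\<Sum>j<n. A i j * x $ j) = b i"
    by blast
  then show ?thesis by (rule exI[of _ "\<lambda>j. x $ j"])
qed

text \<open>Cramer's rule: the unknown is a quotient of two determinants with entries in \<open>L\<close>.\<close>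
lemma nondegenerate_solution_in_subfield:
  assumes nd: "nondegenerate n A" and L: "is_subfield L"
    and A: "\<And>i j. i < n \<Longrightarrow> j < n \<Longrightarrow> A i j \<in> L"
    and b: "\<And>i. i < n \<Longrightarrow> (\<Sum>j<n. A i j * x j) \<in> L" and k: "k < n"
  shows "x k \<in> L"
proof -
  let ?M = "mat n n (\<lambda>(i, j). A i j)"
  let ?b = "?M *\<^sub>v vec n x"
  have sr: "is_subring L" using L by (rule subfield_imp_subring)
  have det_L: "det M \<in> L" if M: "M \<in> carrier_mat n n" "\<And>i j. i < n \<Longrightarrow> j < n \<Longrightarrow> M $$ (i, j) \<in> L" for M
  proof -
    have "signof p * (\<Prod>i = 0..<n. M $$ (i, p i)) \<in> L" if "p permutes {0..<n}" for p
    proof (intro subring_mult[OF sr] subring_prod[OF sr])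
      show "signof p \<in> L" using sr by (auto simp: sign_def subringD)
      fix i assume "i \<in> {0..<n}"
      then show "M $$ (i, p i) \<in> L"
        using permutes_in_image[OF that, of i] by (intro M) auto
    qed
    then show ?thesis unfolding det_def'[OF M(1)] by (intro subring_sum[OF sr]) auto
  qed
  have "det (replace_col ?M ?b k) = vec n x $ k * det ?M"
    by (rule cramer_lemma_mat) (use k in auto)
  moreover have "det ?M \<noteq> 0" using nd by (simp add: nondegenerate_iff_det)
  ultimately have "x k = det (replace_col ?M ?b k) / det ?M" using k by simp
  moreover have "det ?M \<in> L" by (rule det_L) (use A in auto)
  moreover have "det (replace_col ?M ?b k) \<in> L"
    by (rule det_L) (use A b in \<open>auto simp: replace_col_def mult_mat_vec_fun\<close>)
  ultimately show ?thesis using L by (simp add: subfield_divide)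
qed

section \<open>Additive polynomials over the finite field\<close>

lemma finite_field_power_card:
  fixes x :: "'a::{field,finite}"
  shows "x ^ CARD('a) = x"
proof (cases "x = 0")
  case False
  have "x * (\<Prod>y\<in>UNIV-{0}. x * y) = x * x ^ (CARD('a) - 1) * \<Prod>(UNIV-{0})"
    by (simp add: prod.distrib mult_ac)
  also have "x * x ^ (CARD('a) - 1) = x ^ Suc (CARD('a) - 1)"
    by (subst power_Suc) auto
  also have "Suc (CARD('a) - 1) = CARD('a)"
    by simp
  also have "(\<Prod>y\<in>UNIV-{0}. x * y) = (\<Prod>y\<in>UNIV-{0}. y)"
    by (rule prod.reindex_bij_witness[of _ "\<lambda>y. y / x" "\<lambda>y. x * y"]) (use False in auto)
  finally show ?thesis
    by simp
qed simp

lemma finite_field_power_card_power: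
  fixes x :: "'a::{field,finite}"
  shows "x ^ (CARD('a) ^ k) = x"
  by (induction k) (simp_all add: finite_field_power_card power_mult)

lemma card_field_gt_1: "CARD('a::{field,finite}) > 1"
proof -
  have "card {0, 1 :: 'a} \<le> CARD('a)" by (rule card_mono) auto
  then show ?thesis by simp
qed

text \<open>With \<open>q\<close> the cardinality of the field, the polynomial \<open>(T + 1)^q - T^q - 1\<close> has degree below \<open>q\<close> and
vanishes on the whole field, because taking \<open>q\<close>-th powers is the identity there; so all its
coefficients vanish. This makes the \<open>q\<close>-th power map additive in every extension, without the
knowledge that \<open>q\<close> is a power of the characteristic.\<close>
lemma card_choose_eq_0:
  assumes "0 < k" "k < CARD('a::{field,finite})"
  shows "of_nat (CARD('a) choose k) = (0 :: 'a)"
proof -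
  let ?q = "CARD('a)"
  define p :: "'a poly" where "p = (\<Sum>k\<in>{1..<?q}. monom (of_nat (?q choose k)) k)"
  have "p = 0"
  proof (rule poly_eqI_degree[of UNIV])
    fix a :: 'a
    have "a + 1 = (a + 1) ^ ?q" by (simp add: finite_field_power_card)
    also have "\<dots> = (\<Sum>k\<le>?q. of_nat (?q choose k) * a ^ k)"
      by (subst binomial_ring) simp
    also have "{..?q} = insert 0 (insert ?q {1..<?q})" using card_field_gt_1[where 'a='a] by auto
    also have "(\<Sum>k\<in>\<dots>. of_nat (?q choose k) * a ^ k) = 1 + (a ^ ?q + poly p a)"
      by (subst sum.insert) (auto simp: p_def poly_sum poly_monom)
    finally show "poly p a = poly 0 a" by (simp add: finite_field_power_card)
  next
    show "degree p < CARD('a)"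
      unfolding p_def
      by (rule degree_sum_less) (auto intro: le_less_trans[OF degree_monom_le])
  qed simp
  then have "poly.coeff p k = 0" by simp
  moreover have "poly.coeff p k = of_nat (?q choose k)"
    using assms by (auto simp: p_def coeff_sum sum.delta)
  ultimately show ?thesis by simp
qed

lemma of_nat_ratfun: "of_nat k = Const (of_nat k)"
  by (simp add: Const.hom_of_nat)

lemma frobenius_add:
  fixes x y :: "'a::{field,finite} ratfun"
  shows "(x + y) ^ CARD('a) = x ^ CARD('a) + y ^ CARD('a)"
proof -
  let ?q = "CARD('a)"
  have "(x + y) ^ ?q = (\<Sum>k\<le>?q. of_nat (?q choose k) * x ^ k * y ^ (?q - k))"
    by (rule binomial_ring)
  also have "\<dots> = (\<Sum>k\<in>{0, ?q}. of_nat (?q choose k) * x ^ k * y ^ (?q - k))"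
  proof (intro sum.mono_neutral_right ballI)
    fix k assume "k \<in> {..?q} - {0, ?q}"
    then have "of_nat (?q choose k) = (0 :: 'a)" by (intro card_choose_eq_0) auto
    then have "of_nat (?q choose k) = (0 :: 'a ratfun)"
      using of_nat_ratfun[of "?q choose k", where 'a='a] by (simp only: Const_0)
    then show "of_nat (?q choose k) * x ^ k * y ^ (?q - k) = 0" by simp
  qed auto
  finally show ?thesis
    by (simp add: add_ac)
qed

lemma frobenius_power_add:
  fixes x y :: "'a::{field,finite} ratfun"
  shows "(x + y) ^ (CARD('a) ^ k) = x ^ (CARD('a) ^ k) + y ^ (CARD('a) ^ k)"
proof (induction k)
  case (Suc k)
  have "z ^ (CARD('a) ^ Suc k) = (z ^ (CARD('a) ^ k)) ^ CARD('a)" for z :: "'a ratfun"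
    by (subst power_Suc2) (rule power_mult)
  then show ?case
    by (simp only: Suc frobenius_add)
qed simp

lemma frobenius_power_sum:
  fixes f :: "'b \<Rightarrow> 'a::{field,finite} ratfun"
  shows "(\<Sum>i\<in>I. Const (a i) * f i) ^ (CARD('a) ^ k) = (\<Sum>i\<in>I. Const (a i) * f i ^ (CARD('a) ^ k))"
proof (induction I rule: infinite_finite_induct)
  case (insert i I)
  have "Const (a i) ^ (CARD('a) ^ k) = Const (a i)"
    by (simp flip: Const.hom_power add: finite_field_power_card_power)
  with insert show ?case by (simp add: frobenius_power_add power_mult_distrib)
qed simp_all

lemma frobenius_power_inj:
  fixes x y :: "'a::{field,finite} ratfun"
  assumes "x ^ (CARD('a) ^ k) = y ^ (CARD('a) ^ k)"
  shows "x = y"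
proof -
  have "x ^ (CARD('a) ^ k) = (x - y) ^ (CARD('a) ^ k) + y ^ (CARD('a) ^ k)"
    using frobenius_power_add[of "x - y" y k] by simp
  with assms show ?thesis by simp
qed

definition lin_comb :: "nat set \<Rightarrow> (nat \<Rightarrow> 'a) \<Rightarrow> 'a::field ratfun" where
  "lin_comb J a = (\<Sum>i\<in>J. Const (a i) * Var i)"

text \<open>Distinct variables are distinct monomials; the coefficients are read off there.\<close>
lemma Var_independent:
  assumes "finite J" "lin_comb J a = lin_comb J b" "i \<in> J"
  shows "a i = b i"
proof -
  let ?P = "\<lambda>a. \<Sum>i\<in>J. Poly_Mapping.single (Poly_Mapping.single i (1::nat)) (a i)"
  have eq: "lin_comb J a = emb (?P a)" for a :: "nat \<Rightarrow> 'a"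
    by (simp add: lin_comb_def emb.hom_sum Const_eq_emb Var_eq_emb mult_single flip: emb.hom_mult)
  have "Poly_Mapping.lookup (?P a) (Poly_Mapping.single i 1) = a i" for a
  proof -
    have "Poly_Mapping.lookup (?P a) (Poly_Mapping.single i 1) =
        (\<Sum>j\<in>J. if j = i then a j else 0)"
      unfolding lookup_sum
    proof (rule sum.cong[OF refl])
      fix j
      have "Poly_Mapping.single j (1::nat) = Poly_Mapping.single i 1 \<longleftrightarrow> j = i"
        by (metis lookup_single_eq lookup_single_not_eq zero_neq_one)
      then show "Poly_Mapping.lookup (Poly_Mapping.single (Poly_Mapping.single j (1::nat)) (a j))
          (Poly_Mapping.single i 1) = (if j = i then a j else 0)"
        by (simp add: lookup_single when_def)
    qed
    then show ?thesis using assms by simp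
  qed
  moreover have "?P a = ?P b" using assms(2) by (simp add: eq del: One_nat_def)
  ultimately show ?thesis by metis
qed

abbreviation lin_span :: "nat set \<Rightarrow> 'a::field ratfun set" where
  "lin_span J \<equiv> range (lin_comb J)"

lemma lin_span_PiE: "lin_span J = lin_comb J ` (J \<rightarrow>\<^sub>E UNIV)"
proof -
  have "lin_comb J a \<in> lin_comb J ` (J \<rightarrow>\<^sub>E UNIV)" for a
    by (rule image_eqI[of _ _ "restrict a J"]) (auto simp: lin_comb_def)
  then show ?thesis by auto
qed

lemma card_lin_span:
  assumes "finite J"
  shows "card (lin_span J :: 'a::{field,finite} ratfun set) = CARD('a) ^ card J"
proof -
  have "inj_on (lin_comb J) (J \<rightarrow>\<^sub>E (UNIV :: 'a set))"
    by (intro inj_onI PiE_ext) (use Var_independent[OF assms] in blast)+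
  then show ?thesis
    using assms by (simp add: lin_span_PiE card_image card_PiE)
qed

lemma finite_lin_span: "finite J \<Longrightarrow> finite (lin_span J :: 'a::{field,finite} ratfun set)"
  unfolding lin_span_PiE by (intro finite_imageI finite_PiE) auto

lemma frobenius_lin_comb:
  fixes a :: "nat \<Rightarrow> 'a::{field,finite}"
  shows "lin_comb J a ^ (CARD('a) ^ k) = (\<Sum>j\<in>J. Const (a j) * Var j ^ (CARD('a) ^ k))"
  by (simp add: lin_comb_def frobenius_power_sum)

lemma additive_eval_lin_comb:
  fixes c :: "nat \<Rightarrow> 'a::{field,finite} ratfun" and a :: "nat \<Rightarrow> 'a"
  shows "(\<Sum>i\<in>I. c i * lin_comb J a ^ (CARD('a) ^ e i)) =
    (\<Sum>j\<in>J. Const (a j) * (\<Sum>i\<in>I. c i * Var j ^ (CARD('a) ^ e i)))"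
  unfolding frobenius_lin_comb sum_distrib_left by (subst sum.swap) (simp add: mult_ac)

text \<open>An additive polynomial \<open>\<Sum>i<m. c i * T^(q^i)\<close> has degree below \<open>q^m\<close>. If it kills \<open>m\<close> independent
elements, it kills the \<open>q^m\<close> elements of their span, hence is zero. The shift \<open>s\<close> replaces the
variables by their \<open>q^s\<close>-th powers, which is harmless since Frobenius is injective. This is the
nonvanishing of the Moore determinant.\<close>
lemma moore_independent:
  fixes c :: "nat \<Rightarrow> 'a::{field,finite} ratfun"
  assumes J: "finite J" "card J = m"
    and 0: "\<And>j. j \<in> J \<Longrightarrow> (\<Sum>i<m. c i * Var j ^ (CARD('a) ^ (i + s))) = 0"
    and "i < m"
  shows "c i = 0"
proof -
  let ?q = "CARD('a)"
  define p where "p = (\<Sum>i<m. monom (c i) (?q ^ i))"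
  define U where "U = (\<lambda>v. v ^ (?q ^ s)) ` (lin_span J :: 'a ratfun set)"
  have "inj_on (\<lambda>v. v ^ (?q ^ s)) (lin_span J :: 'a ratfun set)"
    by (rule inj_onI) (rule frobenius_power_inj)
  then have U: "card U = ?q ^ m"
    unfolding U_def using J by (simp add: card_image card_lin_span)
  have q: "?q > 1" by (rule card_field_gt_1)
  have "p = 0"
  proof (rule poly_eqI_degree[of U])
    fix u assume "u \<in> U"
    then obtain a where u: "u = lin_comb J a ^ (?q ^ s)" by (auto simp: U_def)
    have "poly p u = (\<Sum>i<m. c i * lin_comb J a ^ (?q ^ (i + s)))"
      by (simp add: p_def poly_sum poly_monom u power_add mult.commute flip: power_mult)
    also have "\<dots> = 0"
      using 0 by (simp add: additive_eval_lin_comb)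
    finally show "poly p u = poly 0 u" by simp
  next
    show "degree p < card U"
      unfolding p_def U
      by (rule degree_sum_less) (use q in \<open>auto intro: le_less_trans[OF degree_monom_le]\<close>)
  next
    show "degree 0 < card U" using U q by simp
  qed
  then have "poly.coeff p (?q ^ i) = 0" by simp
  moreover have "poly.coeff p (?q ^ i) = (\<Sum>j<m. if j = i then c j else 0)"
    unfolding p_def coeff_sum by (rule sum.cong) (use q in \<open>auto simp: power_inject_exp\<close>)
  ultimately show ?thesis using \<open>i < m\<close> by simp
qed

lemma nondegenerateD:
  assumes "nondegenerate n A" "\<And>i. i < n \<Longrightarrow> (\<Sum>j<n. A i j * x j) = 0" "j < n"
  shows "x j = 0"
  using assms(1)[unfolded nondegenerate_def, THEN spec[of _ x]] assms(2,3) by simp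

lemma moore_nondegenerate:
  "nondegenerate n (\<lambda>j i. Var j ^ (CARD('a::{field,finite}) ^ i) :: 'a ratfun)"
  unfolding nondegenerate_def
  using moore_independent[of "{..<n}" n _ 0] by (auto simp: mult.commute)

text \<open>The coefficients of the additive polynomial \<open>T^(q^n) - \<Sum>i<n. c i * T^(q^i)\<close> that vanishes on the span
of the first \<open>n\<close> variables; up to sign, these are the Dickson invariants.\<close>
definition dickson_coeffs :: "nat \<Rightarrow> (nat \<Rightarrow> 'a::{field,finite} ratfun) \<Rightarrow> bool" where
  "dickson_coeffs n c \<longleftrightarrow>
     (\<forall>j<n. Var j ^ (CARD('a) ^ n) = (\<Sum>i<n. c i * Var j ^ (CARD('a) ^ i)))"

lemma dickson_coeffs_exist: "\<exists>c. dickson_coeffs n (c :: nat \<Rightarrow> 'a::{field,finite} ratfun)"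
proof -
  obtain c where "\<forall>j<n. (\<Sum>i<n. Var j ^ (CARD('a) ^ i) * c i) = (Var j ^ (CARD('a) ^ n) :: 'a ratfun)"
    using nondegenerate_solvable[OF moore_nondegenerate, of n "\<lambda>j. Var j ^ (CARD('a) ^ n)"] by blast
  then show ?thesis unfolding dickson_coeffs_def by (intro exI[of _ c]) (simp add: mult.commute)
qed

lemma dickson_coeffs_lin_span:
  assumes "dickson_coeffs n c" "v \<in> lin_span {..<n}"
  shows "v ^ (CARD('a::{field,finite}) ^ n) = (\<Sum>i<n. c i * (v :: 'a ratfun) ^ (CARD('a) ^ i))"
proof -
  obtain a where v: "v = lin_comb {..<n} a" using assms(2) by auto
  have "(\<Sum>i<n. c i * v ^ (CARD('a) ^ i)) = (\<Sum>j<n. Const (a j) * Var j ^ (CARD('a) ^ n))"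
    using assms(1) by (simp add: v additive_eval_lin_comb dickson_coeffs_def)
  then show ?thesis by (simp add: v frobenius_lin_comb)
qed

definition dickson_poly :: "nat \<Rightarrow> (nat \<Rightarrow> 'a::{field,finite} ratfun) \<Rightarrow> 'a ratfun poly" where
  "dickson_poly n c = monom 1 (CARD('a) ^ n) - (\<Sum>i<n. monom (c i) (CARD('a) ^ i))"

lemma monic_linear_prod:
  "finite (U :: 'k::field set) \<Longrightarrow> lead_coeff (\<Prod>u\<in>U. [:- u, 1:]) = 1 \<and> degree (\<Prod>u\<in>U. [:- u, 1:]) = card U"
proof (induction U rule: finite_induct)
  case (insert u U)
  then have "(\<Prod>u\<in>U. [:- u, 1:]) \<noteq> 0" by auto
  with insert have "degree ([:- u, 1:] * (\<Prod>u\<in>U. [:- u, 1:])) = Suc (card U)"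
    by (subst degree_mult_eq) auto
  moreover have "lead_coeff ([:- u, 1:] * (\<Prod>u\<in>U. [:- u, 1:])) = 1"
    unfolding lead_coeff_mult conjunct1[OF insert.IH] by simp
  ultimately show ?case
    unfolding prod.insert[OF insert.hyps] card_insert_disjoint[OF insert.hyps] by blast
qed simp

text \<open>Both sides are monic of degree \<open>q^n\<close> and vanish on the \<open>q^n\<close> elements of the span.\<close>
lemma dickson_poly_eq_prod:
  assumes "dickson_coeffs n c"
  shows "dickson_poly n c = (\<Prod>v\<in>(lin_span {..<n} :: 'a::{field,finite} ratfun set). [:- v, 1:])"
proof -
  let ?V = "lin_span {..<n} :: 'a ratfun set" and ?q = "CARD('a)"
  have q: "?q > 1" by (rule card_field_gt_1)
  have fin: "finite ?V" by (rule finite_lin_span) simp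
  have card: "card ?V = ?q ^ n" by (simp add: card_lin_span)
  have deg: "degree (\<Sum>i<n. monom (c i) (?q ^ i)) < ?q ^ n"
    by (rule degree_sum_less) (use q in \<open>auto intro: le_less_trans[OF degree_monom_le]\<close>)
  show ?thesis
  proof (rule poly_eqI_degree_lead_coeff[of _ "?q ^ n" _ ?V])
    show "poly.coeff (dickson_poly n c) (?q ^ n) = poly.coeff (\<Prod>v\<in>?V. [:- v, 1:]) (?q ^ n)"
    proof -
      have "poly.coeff (\<Prod>v\<in>?V. [:- v, 1:]) (?q ^ n) = 1"
        using monic_linear_prod[OF fin] card by metis
      then show ?thesis
        using deg by (simp add: dickson_poly_def coeff_eq_0)
    qed
    show "degree (dickson_poly n c) \<le> ?q ^ n"
      unfolding dickson_poly_def using deg by (intro degree_diff_le) (auto simp: degree_monom_le)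
    fix v assume v: "v \<in> ?V"
    then have "poly (\<Prod>v\<in>?V. [:- v, 1:]) v = 0"
      using fin by (auto simp: poly_prod)
    then show "poly (dickson_poly n c) v = poly (\<Prod>v\<in>?V. [:- v, 1:]) v"
      using dickson_coeffs_lin_span[OF assms v]
      by (simp add: dickson_poly_def poly_sum poly_monom)
  qed (use monic_linear_prod[OF fin] card in auto)
qed

lemma lin_subst_in_lin_span:
  assumes "j < n"
  shows "lin_subst n T j \<in> lin_span {..<n}"
  using assms unfolding lin_subst_def lin_comb_def by (auto intro!: range_eqI[of _ _ "\<lambda>k. T $$ (k, j)"])

text \<open>An element of the general linear group permutes the span of the variables, so its image of \<open>c\<close>
solves the same Moore system as \<open>c\<close>, and this system has only one solution.\<close>
lemma dickson_coeffs_invariant: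
  fixes c :: "nat \<Rightarrow> 'a::{field,finite} ratfun"
  assumes c: "dickson_coeffs n c" and T: "T \<in> GL n" and i: "i < n"
  shows "sigma n T (c i) = c i"
proof -
  interpret s: field_hom "sigma n T" by (rule sigma_hom) fact
  obtain T' where T': "T' \<in> GL n" "T * T' = 1\<^sub>m n" using T by (rule GL_inverse)
  have "(\<Sum>i<n. Var j ^ (CARD('a) ^ i) * (sigma n T (c i) - c i)) = 0" if j: "j < n" for j
  proof -
    define v where "v = lin_subst n T' j"
    have v: "v \<in> lin_span {..<n}" unfolding v_def by (rule lin_subst_in_lin_span) fact
    have "sigma n T v = sigma n (T * T') (Var j)"
      by (simp add: v_def sigma_mult[OF T T'(1)] sigma_hom(3)[OF T'(1)])
    then have sv: "sigma n T v = Var j" by (simp add: T'(2) sigma_one)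
    have "sigma n T (v ^ (CARD('a) ^ n)) = sigma n T (\<Sum>i<n. c i * v ^ (CARD('a) ^ i))"
      using dickson_coeffs_lin_span[OF c v] by simp
    then have "Var j ^ (CARD('a) ^ n) = (\<Sum>i<n. sigma n T (c i) * Var j ^ (CARD('a) ^ i))"
      by (simp add: s.hom_power s.hom_sum s.hom_mult sv)
    with c j show ?thesis
      by (simp add: dickson_coeffs_def algebra_simps sum_subtractf)
  qed
  from nondegenerateD[OF moore_nondegenerate this i] have "sigma n T (c i) - c i = 0" .
  then show ?thesis by simp
qed

section \<open>Rational invariants of the general linear group\<close>

lemma nondegenerate_GL:
  assumes "nondegenerate n A"
  shows "mat n n (\<lambda>(i, j). A i j) \<in> GL n"
proof -
  let ?M = "mat n n (\<lambda>(i, j). A i j)"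
  have M: "?M \<in> carrier_mat n n" by simp
  have "det ?M \<noteq> 0" using assms by (simp add: nondegenerate_iff_det)
  from det_non_zero_imp_unit[OF M this, of "()"]
  obtain B where "B \<in> carrier_mat n n" "?M * B = 1\<^sub>m n" "B * ?M = 1\<^sub>m n"
    unfolding Units_def ring_mat_def by auto
  then show ?thesis by (auto simp: GL_def invertible_mat_def inverts_mat_def)
qed

text \<open>The first \<open>k\<close> variables followed by \<open>u\<close> are independent and can be completed to a basis of the span.
Explicitly, \<open>u\<close> involves some \<open>Var m\<close> with \<open>m \<ge> k\<close>; the basis is obtained from the variables by
putting \<open>u\<close> in position \<open>k\<close> and, if \<open>m\<close> differs from \<open>k\<close>, the variable \<open>Var k\<close> in position \<open>m\<close>.\<close>
lemma GL_move_Var: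
  fixes u :: "'a::field ratfun"
  assumes u: "u \<in> lin_span {..<n}" "u \<notin> lin_span {..<k}" and k: "k < n"
  obtains T where "T \<in> GL n" "sigma n T (Var k) = u" "\<forall>j<k. sigma n T (Var j) = Var j"
proof -
  obtain a where a: "u = lin_comb {..<n} a" using u(1) by auto
  have "\<exists>m. k \<le> m \<and> m < n \<and> a m \<noteq> 0"
  proof (rule ccontr)
    assume "\<not> ?thesis"
    then have "u = lin_comb {..<k} a"
      unfolding a lin_comb_def using k by (intro sum.mono_neutral_right) auto
    with u(2) show False by auto
  qed
  then obtain m where m: "k \<le> m" "m < n" "a m \<noteq> 0" by blast
  define \<pi> where "\<pi> j = (if j = m then k else j)" for j
  define A where "A i j = (if j = k then a i else if i = \<pi> j then 1 else 0)" for i j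
  let ?T = "mat n n (\<lambda>(i, j). A i j)"
  have "nondegenerate n A"
    unfolding nondegenerate_def
  proof (intro allI impI)
    fix x j assume x: "\<forall>i<n. (\<Sum>j<n. A i j * x j) = 0" and j: "j < n"
    have "(\<Sum>j<n. A m j * x j) = (\<Sum>j<n. if j = k then a m * x k else 0)"
      by (rule sum.cong) (auto simp: A_def \<pi>_def)
    with x m k have xk: "x k = 0" by simp
    show "x j = 0"
    proof (cases "j = k")
      case False
      have "(\<Sum>j'<n. A (\<pi> j) j' * x j') = (\<Sum>j'<n. if j' = j then x j else 0)"
        using False xk by (intro sum.cong) (auto simp: A_def \<pi>_def split: if_splits)
      moreover have "\<pi> j < n" using j k by (simp add: \<pi>_def)
      ultimately show ?thesis using x j by simp
    qed (simp add: xk)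
  qed
  then have T: "?T \<in> GL n" by (rule nondegenerate_GL)
  have "sigma n ?T (Var k) = u"
    unfolding sigma_hom(3)[OF T] using k by (simp add: lin_subst_def a lin_comb_def A_def)
  moreover have "sigma n ?T (Var j) = Var j" if "j < k" for j
  proof -
    have "sigma n ?T (Var j) = (\<Sum>i<n. Const (if i = j then 1 else 0) * Var i)"
      unfolding sigma_hom(3)[OF T] using that k m(1) by (simp add: lin_subst_def A_def \<pi>_def)
    also have "\<dots> = (\<Sum>i<n. if i = j then Var i else 0)"
      by (rule sum.cong) auto
    finally show ?thesis using that k by simp
  qed
  ultimately show thesis using T that by blast
qed

text \<open>The polynomial rings \<open>C[Var 0, \<dots>, Var (k - 1)]\<close>, one variable at a time. Working with rings instead
of fields makes every element a polynomial expression in the last variable.\<close>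
primrec tower :: "'a::field ratfun set \<Rightarrow> nat \<Rightarrow> 'a ratfun set" where
  "tower C 0 = C"
| "tower C (Suc k) = ring_adjoin (tower C k) (Var k)"

lemma tower_subring: "is_subring C \<Longrightarrow> is_subring (tower C k)"
  by (induction k) (auto intro: ring_adjoin_subring)

lemma tower_mono:
  assumes "is_subring C" "j \<le> k" "f \<in> tower C j"
  shows "f \<in> tower C k"
  using assms(2,3) by (induction k rule: dec_induct) (auto intro: ring_adjoin_base tower_subring assms(1))

lemma tower_Var:
  assumes "is_subring C" "j < k"
  shows "Var j \<in> tower C k"
  using tower_mono[of C "Suc j" k "Var j"] assms by (simp add: ring_adjoin_gen tower_subring)

lemma tower_lin_span:
  fixes C :: "'a::field ratfun set"
  assumes "is_subring C" "range Const \<subseteq> C" "J \<subseteq> {..<k}"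
  shows "lin_span J \<subseteq> tower C k"
proof
  fix v :: "'a ratfun" assume "v \<in> lin_span J"
  then obtain a :: "nat \<Rightarrow> 'a" where v: "v = lin_comb J a" by auto
  have "Const x \<in> tower C k" for x
    using tower_mono[of C 0 k "Const x"] assms by auto
  then show "v \<in> tower C k"
    unfolding v lin_comb_def using assms tower_subring[OF assms(1), of k]
    by (intro subring_sum subring_mult) (auto intro: tower_Var)
qed

lemma tower_hom:
  assumes C: "is_subring C" and h: "comm_ring_hom h" "\<And>f. f \<in> C \<Longrightarrow> h f \<in> R" "is_subring R"
    and x: "\<And>j. j < k \<Longrightarrow> h (Var j) \<in> R" and f: "f \<in> tower C k"
  shows "h f \<in> R"
  using x f
proof (induction k arbitrary: f)
  case (Suc k)
  interpret h: comm_ring_hom h by fact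
  obtain p where p: "poly_over (tower C k) p" "f = poly p (Var k)"
    using Suc.prems(2) by (auto simp: ring_adjoin_def)
  have "h f = (\<Sum>i\<le>degree p. h (poly.coeff p i) * h (Var k) ^ i)"
    by (simp add: p(2) poly_altdef h.hom_sum h.hom_mult h.hom_power)
  also have "\<dots> \<in> R"
    using Suc p(1) h(3) by (intro subring_sum subring_mult subring_power) (auto simp: poly_over_def)
  finally show ?case .
qed (use h in simp)

lemma tower_hom_id:
  assumes C: "is_subring C" and h: "comm_ring_hom h" "\<And>f. f \<in> C \<Longrightarrow> h f = f"
    and x: "\<And>j. j < k \<Longrightarrow> h (Var j) = Var j" and f: "f \<in> tower C k"
  shows "h f = f"
  using x f
proof (induction k arbitrary: f)
  case (Suc k)
  interpret h: comm_ring_hom h by fact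
  obtain p where p: "poly_over (tower C k) p" "f = poly p (Var k)"
    using Suc.prems(2) by (auto simp: ring_adjoin_def)
  then show ?case
    using Suc by (simp add: poly_altdef h.hom_sum h.hom_mult h.hom_power poly_over_def)
qed (use h in simp)

text \<open>An invariant descends the tower one variable at a time. The variable \<open>Var k\<close> is a root of
\<open>\<Prod>(T - u)\<close> over all \<open>u\<close> in the span of all \<open>n\<close> variables but outside the span of the first \<open>k\<close>. This
product is the quotient of the Dickson polynomial, whose coefficients lie in \<open>C\<close>, by a monic
polynomial over \<open>tower C k\<close>, hence has coefficients there. The matrices that fix the first \<open>k\<close>
variables move \<open>Var k\<close> to each of these roots, so that \<open>ring_adjoin_descent\<close> applies.\<close>
lemma tower_invariants:
  fixes C :: "'a::{field,finite} ratfun set"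
  assumes C: "is_subring C" "range Const \<subseteq> C"
    and fixed: "\<And>f T. f \<in> C \<Longrightarrow> T \<in> GL n \<Longrightarrow> sigma n T f = f"
    and c: "dickson_coeffs n c" "\<And>i. i < n \<Longrightarrow> c i \<in> C"
    and f: "\<And>T. T \<in> GL n \<Longrightarrow> sigma n T f = f"
    and "k \<le> n" "f \<in> tower C k"
  shows "f \<in> C"
  using \<open>k \<le> n\<close> \<open>f \<in> tower C k\<close>
proof (induction k)
  case (Suc k)
  let ?R = "tower C k" and ?V = "lin_span {..<n} :: 'a ratfun set" and ?W = "lin_span {..<k} :: 'a ratfun set"
  let ?B = "\<Prod>u\<in>?W. [:- u, 1:]" and ?D = "\<Prod>u\<in>?V - ?W. [:- u, 1:]"
  have k: "k < n" using Suc.prems by simp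
  have R: "is_subring ?R" by (rule tower_subring) fact
  have fin: "finite ?V" "finite ?W" by (simp_all add: finite_lin_span)
  have WV: "?W \<subseteq> ?V"
  proof
    fix u assume "u \<in> ?W"
    then obtain a where "u = lin_comb {..<k} a" by auto
    also have "\<dots> = lin_comb {..<n} (\<lambda>i. if i < k then a i else 0)"
      unfolding lin_comb_def using k by (intro sum.mono_neutral_cong_left) auto
    finally show "u \<in> ?V" by auto
  qed
  have WR: "?W \<subseteq> ?R" by (rule tower_lin_span) (use C in auto)
  have BD: "?B * ?D = dickson_poly n c"
    using prod.union_disjoint[of ?W "?V - ?W" "\<lambda>u. [:- u, 1:]"] fin WV
    by (simp add: dickson_poly_eq_prod[OF c(1)] Un_absorb1)
  have "f \<in> ?R"
  proof (rule ring_adjoin_descent[of _ ?D "Var k" "?V - ?W"])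
    show "poly_over ?R ?D"
    proof (rule poly_over_monic_quotient[of _ ?B])
      show "poly_over ?R ?B"
        using R WR by (intro poly_over_prod) (auto simp: poly_over_pCons poly_over_0 subringD)
      have "c i \<in> ?R" if "i < n" for i
        using tower_mono[of C 0 k "c i"] C c that by simp
      then show "poly_over ?R (?B * ?D)"
        unfolding BD dickson_poly_def using R
        by (intro poly_over_diff poly_over_sum poly_over_monom) (auto simp: subring_1)
    qed (use R monic_linear_prod[OF fin(2)] in auto)
    have "Var k \<in> ?V - ?W"
    proof
      have "(Var k :: 'a ratfun) = (\<Sum>i<n. if i = k then Var i else 0)" using k by simp
      also have "\<dots> = lin_comb {..<n} (\<lambda>i. if i = k then 1 else 0)"
        unfolding lin_comb_def by (intro sum.cong) auto
      finally show V: "Var k \<in> ?V" by auto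
      show "Var k \<notin> ?W"
      proof
        assume "Var k \<in> ?W"
        then obtain a :: "nat \<Rightarrow> 'a" where a: "Var k = lin_comb {..<k} a" by auto
        have "lin_comb {..<Suc k} (\<lambda>i. if i = k then 1 else 0) = (Var k :: 'a ratfun)"
          by (simp add: lin_comb_def lessThan_Suc)
        also have "\<dots> = lin_comb {..<Suc k} (\<lambda>i. if i = k then 0 else a i)"
          unfolding a by (simp add: lin_comb_def lessThan_Suc)
        finally show False
          using Var_independent[of "{..<Suc k}" "\<lambda>i. if i = k then 1 else 0"
              "\<lambda>i. if i = k then 0 else a i" k] by simp
      qed
    qed
    then show "poly ?D (Var k) = 0"
      using fin by (auto simp: poly_prod intro!: prod_zero)
    show "\<exists>h. comm_ring_hom h \<and> (\<forall>a\<in>?R. h a = a) \<and> h (Var k) = u \<and> h f = f" if "u \<in> ?V - ?W" for u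
    proof -
      have u: "u \<in> ?V" "u \<notin> ?W" using that by auto
      obtain T where T: "T \<in> GL n" "sigma n T (Var k) = u" "\<forall>j<k. sigma n T (Var j) = Var j"
        using u k by (rule GL_move_Var)
      interpret s: field_hom "sigma n T" by (rule sigma_hom) fact
      have "sigma n T a = a" if "a \<in> ?R" for a
        by (rule tower_hom_id[OF C(1) s.comm_ring_hom_axioms _ _ that]) (use fixed T in auto)
      with T f s.comm_ring_hom_axioms show ?thesis by blast
    qed
    show "f \<in> ring_adjoin ?R (Var k)" using Suc.prems by simp
  qed (use R monic_linear_prod[of "?V - ?W"] fin in auto)
  with Suc show ?case by simp
qed simp

lemma adjoin_subfield: "is_subfield (adjoin A)"
  unfolding adjoin_def is_subfield_def by blast

lemma adjoin_Const: "Const c \<in> adjoin A"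
  unfolding adjoin_def by blast

lemma adjoin_gen: "f \<in> A \<Longrightarrow> f \<in> adjoin A"
  unfolding adjoin_def by blast

lemma adjoin_least: "is_subfield L \<Longrightarrow> range Const \<subseteq> L \<Longrightarrow> A \<subseteq> L \<Longrightarrow> adjoin A \<subseteq> L"
  unfolding adjoin_def by blast

lemma subring_fractions_subfield:
  fixes R :: "'k::field set"
  assumes R: "is_subring R"
  shows "is_subfield {p / r | p r. p \<in> R \<and> r \<in> R \<and> r \<noteq> 0}" (is "is_subfield ?F")
  unfolding is_subfield_def
proof (intro conjI ballI)
  have *: "p / r \<in> ?F" if "p \<in> R" "r \<in> R" for p r
  proof (cases "r = 0")
    case True
    then have "p / r = 0 / 1 \<and> 0 \<in> R \<and> 1 \<in> R \<and> (1 :: 'k) \<noteq> 0"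
      using R by (simp add: subring_0 subring_1)
    then show ?thesis by (intro CollectI exI)
  qed (use that in blast)
  show "0 \<in> ?F" "1 \<in> ?F" using *[of 0 1] *[of 1 1] R by (auto simp: subringD)
  fix x assume "x \<in> ?F"
  then obtain p r where x: "x = p / r" "p \<in> R" "r \<in> R" "r \<noteq> 0" by auto
  then show "- x \<in> ?F" "inverse x \<in> ?F"
    using *[of "- p" r] *[of r p] R by (simp_all add: subringD)
  fix y assume "y \<in> ?F"
  then obtain p' r' where y: "y = p' / r'" "p' \<in> R" "r' \<in> R" "r' \<noteq> 0" by auto
  have "x + y = (p * r' + p' * r) / (r * r')" "x * y = (p * p') / (r * r')"
    unfolding x(1) y(1) using x(4) y(4) by (simp_all add: field_simps)
  moreover have "(p * r' + p' * r) / (r * r') \<in> ?F" "(p * p') / (r * r') \<in> ?F"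
    using x(2,3) y(2,3) R by (intro *; simp add: subring_add subring_mult)+
  ultimately show "x + y \<in> ?F" "x * y \<in> ?F"
    by (simp_all only:)
qed

text \<open>Dickson's theorem for rational functions: the invariants of the general linear group form the
smallest field that contains the constants and the Dickson invariants. A rational invariant becomes
a quotient of two polynomial ones after its numerator and denominator are multiplied by the product
of the other conjugates of the denominator; \<open>tower_invariants\<close> applies to both.\<close>
lemma GL_invariants:
  fixes C :: "'a::{field,finite} ratfun set"
  assumes C: "is_subfield C" "range Const \<subseteq> C"
    and fixed: "\<And>f T. f \<in> C \<Longrightarrow> T \<in> GL n \<Longrightarrow> sigma n T f = f"
    and c: "dickson_coeffs n c" "\<And>i. i < n \<Longrightarrow> c i \<in> C"
    and f: "f \<in> fixed_field n (GL n)"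
  shows "f \<in> C"
proof -
  let ?R = "tower C n"
  have sr: "is_subring C" using C(1) by (rule subfield_imp_subring)
  have R: "is_subring ?R" using sr by (rule tower_subring)
  have inv: "sigma n T f = f" if "T \<in> GL n" for T using f that by (simp add: fixed_field_def)
  have "adjoin (Var ` {..<n}) \<subseteq> {p / r | p r. p \<in> ?R \<and> r \<in> ?R \<and> r \<noteq> 0}" (is "_ \<subseteq> ?F")
  proof (rule adjoin_least)
    have *: "p \<in> ?F" if "p \<in> ?R" for p
    proof -
      have "p = p / 1 \<and> p \<in> ?R \<and> 1 \<in> ?R \<and> (1 :: 'a ratfun) \<noteq> 0"
        using that R by (simp add: subring_1)
      then show ?thesis by (intro CollectI exI)
    qed
    show "is_subfield ?F" using R by (rule subring_fractions_subfield)
    show "range Const \<subseteq> ?F" using C(2) * tower_mono[OF sr, of 0 n] by auto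
    show "Var ` {..<n} \<subseteq> ?F" using * tower_Var[OF sr, of _ n] by auto
  qed
  then obtain p r where pr: "f = p / r" "p \<in> ?R" "r \<in> ?R" "r \<noteq> 0"
    using f by (auto simp: fixed_field_def)
  \<comment> \<open>\<open>N\<close> is the norm of the denominator, \<open>N'\<close> its cofactor: \<open>f = (p * N') / (r * N')\<close>.\<close>
  define N' where "N' = (\<Prod>T\<in>GL n - {1\<^sub>m n}. sigma n T r)"
  define N where "N = (\<Prod>T\<in>GL n. sigma n T r)"
  have N: "N = r * N'"
    unfolding N_def N'_def by (subst prod.remove[OF finite_GL one_in_GL]) (simp add: sigma_one)
  have stable: "sigma n T g \<in> ?R" if T: "T \<in> GL n" and g: "g \<in> ?R" for T g
  proof -
    interpret s: field_hom "sigma n T" by (rule sigma_hom) fact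
    show ?thesis
    proof (rule tower_hom[OF sr s.comm_ring_hom_axioms _ R _ g])
      show "sigma n T f \<in> ?R" if "f \<in> C" for f
        using fixed[OF that T] tower_mono[OF sr, of 0 n f] that by simp
      show "sigma n T (Var j) \<in> ?R" if "j < n" for j
        using lin_subst_in_lin_span[OF that, of T] tower_lin_span[OF sr C(2), of "{..<n}" n]
        by (auto simp: sigma_hom(3)[OF T])
    qed
  qed
  have "N \<noteq> 0"
  proof -
    have "sigma n T r \<noteq> 0" if T: "T \<in> GL n" for T
    proof -
      interpret s: field_hom "sigma n T" by (rule sigma_hom) fact
      show ?thesis using pr(4) by simp
    qed
    then show ?thesis unfolding N_def by (simp add: finite_GL)
  qed
  have invN: "sigma n A N = N" if A: "A \<in> GL n" for A
  proof -
    interpret s: field_hom "sigma n A" by (rule sigma_hom) fact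
    obtain A' where A': "A' \<in> GL n" "A * A' = 1\<^sub>m n" "A' * A = 1\<^sub>m n" using A by (rule GL_inverse)
    have car: "T \<in> carrier_mat n n" if "T \<in> GL n" for T :: "'a mat" using that by (simp add: GL_def)
    have "sigma n A N = (\<Prod>T\<in>GL n. sigma n (A * T) r)"
      unfolding N_def s.hom_prod by (rule prod.cong) (simp_all add: sigma_mult A)
    also have "\<dots> = N"
      unfolding N_def
    proof (rule prod.reindex_bij_witness[of _ "\<lambda>T. A' * T" "\<lambda>T. A * T"])
      fix T :: "'a mat" assume T: "T \<in> GL n"
      show "A' * (A * T) = T" "A * (A' * T) = T"
        using car[OF T] car[OF A] car[OF A'(1)] A'
        by (simp_all flip: assoc_mult_mat[of _ n n _ n _ n])
      show "A * T \<in> GL n" "A' * T \<in> GL n" using A A' T by (auto intro: GL_mult)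
    qed simp
    finally show ?thesis .
  qed
  have mem: "r * N' \<in> ?R" "p * N' \<in> ?R"
    unfolding N'_def using R pr by (auto intro!: subring_mult subring_prod stable)
  have "f * N \<in> C"
  proof (rule tower_invariants[OF sr C(2) fixed c _ order_refl])
    fix T :: "'a mat" assume T: "T \<in> GL n"
    interpret s: field_hom "sigma n T" by (rule sigma_hom) fact
    show "sigma n T (f * N) = f * N" using T by (simp add: s.hom_mult inv invN)
  next
    show "f * N \<in> ?R" using mem pr by (simp add: N)
  qed auto
  moreover have "N \<in> C"
    by (rule tower_invariants[OF sr C(2) fixed c invN order_refl]) (use mem N in auto)
  ultimately have "f * N / N \<in> C" using C(1) by (intro subfield_divide)
  then show ?thesis using \<open>N \<noteq> 0\<close> by simp
qed

section \<open>Bilinear forms in the variables and their Frobenius twists\<close>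

definition bil :: "nat \<Rightarrow> 'a::field mat \<Rightarrow> (nat \<Rightarrow> 'a ratfun) \<Rightarrow> (nat \<Rightarrow> 'a ratfun) \<Rightarrow> 'a ratfun" where
  "bil n A x y = (\<Sum>i<n. \<Sum>j<n. Const (A $$ (i, j)) * (x i * y j))"

lemma bil_cong:
  "(\<And>i. i < n \<Longrightarrow> x i = x' i) \<Longrightarrow> (\<And>i. i < n \<Longrightarrow> y i = y' i) \<Longrightarrow> bil n A x y = bil n A x' y'"
  unfolding bil_def by (intro sum.cong) auto

lemma P_form_eq_bil:
  assumes "S \<in> carrier_mat n n"
  shows "P_form n S k = bil n S Var (\<lambda>j. Var j ^ (CARD('a::{field,finite}) ^ k) :: 'a ratfun)"
  using assms by (auto simp: P_form_def bil_def Var_vec_def scalar_prod_def atLeast0LessThan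
      sum_distrib_left mult_ac intro!: sum.cong)

lemma frobenius_power_sum':
  fixes f :: "'b \<Rightarrow> 'a::{field,finite} ratfun"
  shows "(\<Sum>i\<in>I. f i) ^ (CARD('a) ^ k) = (\<Sum>i\<in>I. f i ^ (CARD('a) ^ k))"
  using frobenius_power_sum[of "\<lambda>_. 1" f I k] by simp

lemma bil_frobenius:
  fixes x y :: "nat \<Rightarrow> 'a::{field,finite} ratfun"
  shows "bil n A x y ^ (CARD('a) ^ k) =
    bil n A (\<lambda>i. x i ^ (CARD('a) ^ k)) (\<lambda>j. y j ^ (CARD('a) ^ k))"
proof -
  have "Const c ^ (CARD('a) ^ k) = Const c" for c :: 'a
    by (simp flip: Const.hom_power add: finite_field_power_card_power)
  then show ?thesis
    unfolding bil_def by (simp only: frobenius_power_sum' power_mult_distrib)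
qed

lemma bil_mult_left:
  assumes "T \<in> carrier_mat n n" "A \<in> carrier_mat n n"
  shows "bil n A (\<lambda>i. \<Sum>k<n. Const (T $$ (k, i)) * x k) y = bil n (T * A) x y"
proof -
  have "bil n A (\<lambda>i. \<Sum>k<n. Const (T $$ (k, i)) * x k) y =
      (\<Sum>j<n. \<Sum>i<n. \<Sum>k<n. Const (T $$ (k, i)) * Const (A $$ (i, j)) * (x k * y j))"
    unfolding bil_def
    by (subst sum.swap) (simp add: sum_distrib_left sum_distrib_right mult_ac)
  also have "\<dots> = (\<Sum>j<n. \<Sum>k<n. \<Sum>i<n. Const (T $$ (k, i)) * Const (A $$ (i, j)) * (x k * y j))"
    by (rule sum.cong[OF refl]) (rule sum.swap)
  also have "\<dots> = (\<Sum>j<n. \<Sum>k<n. Const ((T * A) $$ (k, j)) * (x k * y j))"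
  proof (intro sum.cong refl)
    fix j k assume "j \<in> {..<n}" "k \<in> {..<n}"
    then have "(T * A) $$ (k, j) = (\<Sum>i<n. T $$ (k, i) * A $$ (i, j))"
      using assms by (intro mat_mult_entry) auto
    then show "(\<Sum>i<n. Const (T $$ (k, i)) * Const (A $$ (i, j)) * (x k * y j)) =
        Const ((T * A) $$ (k, j)) * (x k * y j)"
      by (simp only: Const.hom_sum Const_mult sum_distrib_right)
  qed
  also have "\<dots> = bil n (T * A) x y" unfolding bil_def by (rule sum.swap)
  finally show ?thesis .
qed

lemma bil_mult_right:
  assumes "T \<in> carrier_mat n n" "A \<in> carrier_mat n n"
  shows "bil n A x (\<lambda>j. \<Sum>l<n. Const (T $$ (l, j)) * y l) = bil n (A * transpose_mat T) x y"
proof -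
  have "bil n A x (\<lambda>j. \<Sum>l<n. Const (T $$ (l, j)) * y l) =
      (\<Sum>i<n. \<Sum>j<n. \<Sum>l<n. Const (A $$ (i, j)) * Const (T $$ (l, j)) * (x i * y l))"
    unfolding bil_def by (simp add: sum_distrib_left mult_ac)
  also have "\<dots> = (\<Sum>i<n. \<Sum>l<n. \<Sum>j<n. Const (A $$ (i, j)) * Const (T $$ (l, j)) * (x i * y l))"
    by (rule sum.cong[OF refl]) (rule sum.swap)
  also have "\<dots> = bil n (A * transpose_mat T) x y"
    unfolding bil_def
  proof (intro sum.cong refl)
    fix i l assume *: "i \<in> {..<n}" "l \<in> {..<n}"
    then have "(A * transpose_mat T) $$ (i, l) = (\<Sum>j<n. A $$ (i, j) * transpose_mat T $$ (j, l))"
      using assms by (intro mat_mult_entry) auto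
    also have "\<dots> = (\<Sum>j<n. A $$ (i, j) * T $$ (l, j))"
      using assms * by (intro sum.cong) auto
    finally show "(\<Sum>j<n. Const (A $$ (i, j)) * Const (T $$ (l, j)) * (x i * y l)) =
        Const ((A * transpose_mat T) $$ (i, l)) * (x i * y l)"
      by (simp only: Const.hom_sum Const_mult sum_distrib_right)
  qed
  finally show ?thesis .
qed

lemma hom_bil:
  assumes "comm_ring_hom h" "\<And>c. h (Const c) = Const c"
  shows "h (bil n A x y) = bil n A (\<lambda>i. h (x i)) (\<lambda>j. h (y j))"
proof -
  interpret h: comm_ring_hom h by fact
  show ?thesis by (simp add: bil_def h.hom_sum h.hom_mult assms(2))
qed

text \<open>Frobenius fixes the entries of \<open>T\<close>, so that \<open>T\<close> acts in the same way on the variables and on their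
\<open>q^k\<close>-th powers; both copies are absorbed into the matrix of the form.\<close>
lemma sigma_P_form:
  fixes A :: "'a::{field,finite} mat"
  assumes T: "T \<in> GL n" and A: "A \<in> carrier_mat n n"
  shows "sigma n T (P_form n A k) = P_form n (T * A * transpose_mat T) k"
proof -
  interpret s: field_hom "sigma n T" by (rule sigma_hom) fact
  have Tc: "T \<in> carrier_mat n n" using T by (simp add: GL_def)
  have "sigma n T (P_form n A k) = bil n A (\<lambda>i. \<Sum>k<n. Const (T $$ (k, i)) * Var k)
      (\<lambda>j. \<Sum>l<n. Const (T $$ (l, j)) * Var l ^ (CARD('a) ^ k))"
    unfolding P_form_eq_bil[OF A] hom_bil[OF s.comm_ring_hom_axioms sigma_hom(2)[OF T]]
    by (rule bil_cong) (simp_all add: s.hom_power sigma_hom(3)[OF T] lin_subst_def frobenius_power_sum)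
  also have "\<dots> = P_form n (T * A * transpose_mat T) k"
    using Tc A by (simp add: bil_mult_left bil_mult_right P_form_eq_bil)
  finally show ?thesis .
qed

text \<open>Since \<open>q \<ge> 2\<close>, the monomials \<open>Var i * Var j ^ q\<close> are distinct for distinct pairs \<open>(i, j)\<close>, so the matrix can
be read off from the coefficients.\<close>
lemma P_form_1_inj:
  fixes A B :: "'a::{field,finite} mat"
  assumes AB: "A \<in> carrier_mat n n" "B \<in> carrier_mat n n" and eq: "P_form n A 1 = P_form n B 1"
  shows "A = B"
proof -
  let ?q = "CARD('a)"
  define m :: "nat \<Rightarrow> nat \<Rightarrow> nat \<Rightarrow>\<^sub>0 nat" where
    "m i j = Poly_Mapping.single i 1 + Poly_Mapping.single j ?q" for i j
  let ?P = "\<lambda>A. \<Sum>i<n. \<Sum>j<n. Poly_Mapping.single (m i j) (A $$ (i, j))"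
  have emb: "P_form n M 1 = emb (?P M)" if "M \<in> carrier_mat n n" for M :: "'a mat"
    unfolding P_form_eq_bil[OF that] bil_def Const_eq_emb Var_eq_emb m_def
    by (simp only: power_one_right single_variable_power emb.hom_sum emb.hom_mult[symmetric] emb.hom_power[symmetric]
        mult_single add_0_left mult_1_right)
  have m_inj: "m i j = m i' j' \<longleftrightarrow> i = i' \<and> j = j'" for i j i' j'
  proof
    assume eq: "m i j = m i' j'"
    have l: "(if i = t then 1 else 0) + (if j = t then ?q else 0) =
        (if i' = t then 1 else 0) + (if j' = t then ?q else 0)" for t
      using arg_cong[OF eq, of "\<lambda>m. Poly_Mapping.lookup m t"]
      by (simp only: m_def lookup_add lookup_single when_def)
    have "j = j'" using l[of j] card_field_gt_1[where 'a='a] by (auto split: if_splits)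
    with l[of i] show "i = i' \<and> j = j'" by (auto split: if_splits)
  qed simp
  have coeff: "Poly_Mapping.lookup (?P M) (m i j) = M $$ (i, j)" if "i < n" "j < n" for M i j
  proof -
    have "Poly_Mapping.lookup (?P M) (m i j) =
        (\<Sum>i'<n. if i' = i then \<Sum>j'<n. if j' = j then M $$ (i', j') else 0 else 0)"
      unfolding lookup_sum by (intro sum.cong refl) (auto simp: lookup_single when_def m_inj intro!: sum.cong sum.neutral)
    then show ?thesis using that by simp
  qed
  have "?P A = ?P B" using eq emb[OF AB(1)] emb[OF AB(2)] by (simp only: emb_eq_iff)
  then have "A $$ (i, j) = B $$ (i, j)" if "i < n" "j < n" for i j
    using coeff[OF that, of A] coeff[OF that, of B] by (simp only:)
  with AB show ?thesis by (intro eq_matI) auto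
qed

section \<open>Lagrange interpolation\<close>

lemma poly_map_poly_hom:
  assumes "comm_ring_hom h"
  shows "poly (map_poly h p) (h x) = h (poly p x)"
proof -
  interpret h: comm_ring_hom h by fact
  show ?thesis by (induction p) (simp_all add: map_poly_pCons h.hom_add h.hom_mult)
qed

lemma interpolation:
  fixes Z :: "'k::field set"
  assumes "finite Z" "Z \<noteq> {}" "is_subfield F" "Z \<subseteq> F" "g ` Z \<subseteq> F"
  shows "\<exists>r. poly_over F r \<and> degree r < card Z \<and> (\<forall>z\<in>Z. poly r z = g z)"
  using assms(1,2,4,5)
proof (induction Z rule: finite_ne_induct)
  case (singleton z)
  have "is_subring F" using assms(3) by (rule subfield_imp_subring)
  with singleton show ?case by (intro exI[of _ "[:g z:]"]) (simp add: poly_over_pCons poly_over_0)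
next
  case (insert z Z)
  have F: "is_subring F" using assms(3) by (rule subfield_imp_subring)
  let ?W = "\<Prod>s\<in>Z. [:- s, 1:]"
  obtain r where r: "poly_over F r" "degree r < card Z" "\<And>t. t \<in> Z \<Longrightarrow> poly r t = g t"
    using insert by auto
  define a where "a = (g z - poly r z) / poly ?W z"
  have W: "poly_over F ?W"
    using F insert.prems by (intro poly_over_prod) (auto simp: poly_over_pCons poly_over_0 subringD)
  have Wz: "poly ?W z \<noteq> 0" using insert.hyps by (auto simp: poly_prod)
  have Wt: "poly ?W t = 0" if "t \<in> Z" for t
    using insert.hyps(1) that by (auto simp: poly_prod)
  have "a \<in> F"
    unfolding a_def using F W r(1) insert.prems
    by (intro subfield_divide[OF assms(3)] subring_diff poly_over_eval) auto
  show ?case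
  proof (intro exI[of _ "r + smult a ?W"] conjI ballI)
    show "poly_over F (r + smult a ?W)"
      using F W r(1) \<open>a \<in> F\<close> by (intro poly_over_add poly_over_smult)
    have "degree (smult a ?W) \<le> card Z"
      using monic_linear_prod[OF insert.hyps(1)] by (metis degree_smult_le)
    with r(2) have "degree (r + smult a ?W) \<le> card Z" by (intro degree_add_le) auto
    then show "degree (r + smult a ?W) < card (insert z Z)"
      using insert.hyps by simp
    fix t assume "t \<in> insert z Z"
    then show "poly (r + smult a ?W) t = g t"
      using r(3) Wt Wz by (auto simp: a_def)
  qed
qed

lemma sigma_adjoin:
  assumes T: "T \<in> GL n" and f: "f \<in> adjoin (Var ` {..<n})"
  shows "sigma n T f \<in> adjoin (Var ` {..<n})"
proof -
  let ?K = "adjoin (Var ` {..<n}) :: 'a::field ratfun set"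
  interpret s: field_hom "sigma n T" by (rule sigma_hom) fact
  have K: "is_subfield ?K" by (rule adjoin_subfield)
  have "adjoin (Var ` {..<n}) \<subseteq> {f. sigma n T f \<in> ?K}"
  proof (rule adjoin_least)
    show "is_subfield {f. sigma n T f \<in> ?K}"
      using K unfolding is_subfield_def
      by (simp add: s.hom_add s.hom_mult s.hom_uminus s.hom_inverse)
    show "range Const \<subseteq> {f. sigma n T f \<in> ?K}"
      by (auto simp: sigma_hom(2)[OF T] adjoin_Const)
    have "lin_subst n T j \<in> ?K" if "j < n" for j
    proof -
      have sr: "is_subring ?K" using K by (rule subfield_imp_subring)
      show ?thesis
        unfolding lin_subst_def if_P[OF that]
        by (intro subring_sum[OF sr] subring_mult[OF sr] adjoin_Const adjoin_gen) auto
    qed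
    then show "Var ` {..<n} \<subseteq> {f. sigma n T f \<in> ?K}"
      by (auto simp: sigma_hom(3)[OF T])
  qed
  with f show ?thesis by auto
qed

text \<open>Lagrange's theorem on rational functions: if the stabilizer of \<open>\<theta>\<close> fixes \<open>f\<close>, then \<open>f\<close> is a
polynomial in \<open>\<theta>\<close> over the invariants. Indeed \<open>T \<theta> \<mapsto> T f\<close> is then a well-defined map on the finite
orbit of \<open>\<theta>\<close>. Its interpolation polynomial is unique, hence fixed by the group coefficientwise, and
takes the value \<open>f\<close> at \<open>\<theta>\<close>.\<close>
lemma invariant_in_field_of_orbit_point:
  fixes f \<theta> :: "'a::{field,finite} ratfun"
  assumes K: "f \<in> adjoin (Var ` {..<n})" "\<theta> \<in> adjoin (Var ` {..<n})"
    and stab: "\<And>T. T \<in> GL n \<Longrightarrow> sigma n T \<theta> = \<theta> \<Longrightarrow> sigma n T f = f"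
    and L: "is_subfield L" "fixed_field n (GL n) \<subseteq> L" "\<theta> \<in> L"
  shows "f \<in> L"
proof -
  let ?K = "adjoin (Var ` {..<n}) :: 'a ratfun set"
  have car: "T \<in> carrier_mat n n" if "T \<in> GL n" for T :: "'a mat" using that by (simp add: GL_def)
  define Z where "Z = (\<lambda>T. sigma n T \<theta>) ` GL n"
  have "finite Z" unfolding Z_def by (intro finite_imageI finite_GL)
  have "Z \<noteq> {}" unfolding Z_def using one_in_GL by auto
  define g where "g z = sigma n (SOME T. T \<in> GL n \<and> sigma n T \<theta> = z) f" for z
  have g: "g (sigma n A \<theta>) = sigma n A f" if A: "A \<in> GL n" for A
  proof -
    define B where "B = (SOME T. T \<in> GL n \<and> sigma n T \<theta> = sigma n A \<theta>)"
    have B: "B \<in> GL n" "sigma n B \<theta> = sigma n A \<theta>"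
      unfolding B_def using A someI[of "\<lambda>T. T \<in> GL n \<and> sigma n T \<theta> = sigma n A \<theta>" A] by auto
    obtain A' where A': "A' \<in> GL n" "A * A' = 1\<^sub>m n" "A' * A = 1\<^sub>m n" using A by (rule GL_inverse)
    have "sigma n (A' * B) \<theta> = sigma n (A' * A) \<theta>"
      by (simp only: sigma_mult[OF A'(1) B(1)] sigma_mult[OF A'(1) A] B(2))
    then have "sigma n (A' * B) f = f"
      using A'(1,3) B(1) by (intro stab GL_mult) (simp_all add: sigma_one)
    then have "sigma n A f = sigma n (A * (A' * B)) f"
      using A A' B(1) by (simp add: sigma_mult GL_mult)
    also have "A * (A' * B) = B"
      using car[OF A] car[OF A'(1)] car[OF B(1)] A'(2) by (simp flip: assoc_mult_mat[of _ n n _ n _ n])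
    finally show ?thesis by (simp add: g_def B_def)
  qed
  have ZK: "Z \<subseteq> ?K" "g ` Z \<subseteq> ?K"
    using K g by (auto simp: Z_def intro: sigma_adjoin)
  from interpolation[OF \<open>finite Z\<close> \<open>Z \<noteq> {}\<close> adjoin_subfield ZK]
  obtain r where r: "poly_over ?K r" "degree r < card Z" "\<And>z. z \<in> Z \<Longrightarrow> poly r z = g z"
    by blast
  have coeffs: "sigma n T (poly.coeff r k) = poly.coeff r k" if T: "T \<in> GL n" for T k
  proof -
    interpret s: field_hom "sigma n T" by (rule sigma_hom) fact
    obtain T' where T': "T' \<in> GL n" "T * T' = 1\<^sub>m n" using T by (rule GL_inverse)
    have deg: "degree (map_poly (sigma n T) r) \<le> degree r"
      by (rule degree_le) (simp add: coeff_map_poly coeff_eq_0)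
    have "map_poly (sigma n T) r = r"
    proof (rule poly_eqI_degree[of Z])
      fix z assume "z \<in> Z"
      then obtain A where A: "A \<in> GL n" "z = sigma n A \<theta>" by (auto simp: Z_def)
      have TA: "T * (T' * A) = A"
        using car[OF T] car[OF T'(1)] car[OF A(1)] T'(2) by (simp flip: assoc_mult_mat[of _ n n _ n _ n])
      define t where "t = sigma n (T' * A) \<theta>"
      have T'A: "T' * A \<in> GL n" using T' A by (intro GL_mult)
      have "sigma n T t = z"
        unfolding t_def A(2) using sigma_mult[OF T T'A, of \<theta>] TA by simp
      moreover have "sigma n T (poly r t) = g z"
        using r(3)[of t] g[OF T'A] g[OF A(1)] sigma_mult[OF T T'A, of f] TA T'A
        by (simp add: t_def A(2) Z_def)
      ultimately show "poly (map_poly (sigma n T) r) z = poly r z"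
        using r(3)[OF \<open>z \<in> Z\<close>] poly_map_poly_hom[OF s.comm_ring_hom_axioms, of r t] by simp
    qed (use r(2) deg in auto)
    then show ?thesis by (metis coeff_map_poly s.hom_zero)
  qed
  have "poly.coeff r k \<in> L" for k
  proof -
    have "poly.coeff r k \<in> fixed_field n (GL n)"
      using r(1) coeffs by (simp add: fixed_field_def poly_over_def)
    with L(2) show ?thesis by blast
  qed
  then have "poly r \<theta> \<in> L"
    using L by (intro poly_over_eval) (auto simp: poly_over_def subfield_imp_subring)
  moreover have "\<theta> \<in> Z" using one_in_GL sigma_one[of n \<theta>] by (force simp: Z_def)
  then have "poly r \<theta> = g (sigma n (1\<^sub>m n) \<theta>)" using r(3) by (simp add: sigma_one)
  ultimately show ?thesis using g[OF one_in_GL] by (simp add: sigma_one)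
qed

section \<open>The pseudo-symplectic form\<close>

text \<open>The involution of the indices that pairs the two members of each hyperbolic plane, and also the last
two indices. The matrix \<open>S_mat\<close> is its permutation matrix plus one further entry 1 in the last
diagonal place.\<close>
definition partner :: "nat \<Rightarrow> nat \<Rightarrow> nat" where
  "partner \<nu> i = (if i < \<nu> then i + \<nu> else if i < 2 * \<nu> then i - \<nu>
     else if i = 2 * \<nu> then 2 * \<nu> + 1 else 2 * \<nu>)"

lemma partner_less: "i < 2 * \<nu> + 2 \<Longrightarrow> partner \<nu> i < 2 * \<nu> + 2"
  by (auto simp: partner_def)

lemma partner_partner: "i < 2 * \<nu> + 2 \<Longrightarrow> partner \<nu> (partner \<nu> i) = i"
  by (auto simp: partner_def)

lemma S_mat_carrier: "S_mat \<nu> \<in> carrier_mat (2 * \<nu> + 2) (2 * \<nu> + 2)"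
  unfolding S_mat_def carrier_mat_def by (simp add: mat_of_rows_list_def)

lemma S_mat_entry:
  assumes "i < 2 * \<nu> + 2" "j < 2 * \<nu> + 2"
  shows "S_mat \<nu> $$ (i, j) = (if i = partner \<nu> j then 1 else 0) +
    (if i = 2 * \<nu> + 1 \<and> j = 2 * \<nu> + 1 then 1 else (0 :: 'a::field))"
proof -
  have "i - 2 * \<nu> = 0 \<or> i - 2 * \<nu> = 1" "j - 2 * \<nu> = 0 \<or> j - 2 * \<nu> = 1" using assms by auto
  then show ?thesis
    using assms unfolding S_mat_def
    by (auto simp: mat_of_rows_list_def partner_def)
qed

lemma bil_S_mat:
  assumes n: "n = 2 * \<nu> + 2"
  shows "bil n (S_mat \<nu>) x y =
    (\<Sum>j<n. (x (partner \<nu> j) + (if j = n - 1 then x (n - 1) else 0)) * y j)"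
proof -
  have "bil n (S_mat \<nu>) x y = (\<Sum>j<n. \<Sum>i<n. Const (S_mat \<nu> $$ (i, j)) * (x i * y j))"
    unfolding bil_def by (rule sum.swap)
  also have "\<dots> = (\<Sum>j<n. (x (partner \<nu> j) + (if j = n - 1 then x (n - 1) else 0)) * y j)"
  proof (rule sum.cong[OF refl])
    fix j assume j: "j \<in> {..<n}"
    have p: "partner \<nu> j < n" "n - 1 < n" using j n partner_less[of j \<nu>] by simp_all
    have "(\<Sum>i<n. Const (S_mat \<nu> $$ (i, j)) * (x i * y j)) =
        (\<Sum>i<n. (if i = partner \<nu> j then x i * y j else 0) +
          (if i = n - 1 then if j = n - 1 then x i * y j else 0 else 0))"
      using j n by (intro sum.cong) (auto simp: S_mat_entry Const_add)
    also have "\<dots> = x (partner \<nu> j) * y j + (if j = n - 1 then x (n - 1) * y j else 0)"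
      using p by (simp add: sum.distrib)
    finally show "(\<Sum>i<n. Const (S_mat \<nu> $$ (i, j)) * (x i * y j)) =
        (x (partner \<nu> j) + (if j = n - 1 then x (n - 1) else 0)) * y j"
      by (simp add: distrib_right)
  qed
  finally show ?thesis .
qed

lemma bil_S_mat_commute:
  assumes n: "n = 2 * \<nu> + 2"
  shows "bil n (S_mat \<nu>) x y = bil n (S_mat \<nu>) y x"
proof -
  have "S_mat \<nu> $$ (i, j) = (S_mat \<nu> $$ (j, i) :: 'a)" if "i < n" "j < n" for i j
    using that n partner_partner[of i \<nu>] partner_partner[of j \<nu>] by (auto simp: S_mat_entry)
  then have "bil n (S_mat \<nu>) x y = (\<Sum>i<n. \<Sum>j<n. Const (S_mat \<nu> $$ (j, i)) * (y j * x i))"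
    unfolding bil_def by (intro sum.cong refl) (simp add: mult.commute)
  also have "\<dots> = bil n (S_mat \<nu>) y x" unfolding bil_def by (rule sum.swap)
  finally show ?thesis .
qed

lemma char_2_add_self:
  assumes "CHAR('a::field) = 2"
  shows "x + x = (0 :: 'a ratfun)"
proof -
  have "(1 + 1 :: 'a) = of_nat 2" by simp
  also have "\<dots> = 0" using of_nat_CHAR[where 'a='a] by (simp only: assms)
  finally have two: "(1 + 1 :: 'a) = 0" .
  have "(1 + 1 :: 'a ratfun) = Const (1 + 1)" by (simp only: Const_add Const_1)
  also have "\<dots> = 0" by (simp only: two Const_0)
  finally have "x * (1 + 1) = 0" by (simp only: mult_zero_right)
  then show ?thesis by (simp only: distrib_left mult_1_right)
qed

lemma sum_lessThan_add:
  fixes m k :: nat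
  shows "(\<Sum>i<m + k. f i) = (\<Sum>i<m. f i) + (\<Sum>i<k. f (m + i) :: 'b::comm_monoid_add)"
  by (induction k) (simp_all add: add_ac)

text \<open>In characteristic two the terms at an index and at its partner cancel, and the last diagonal entry
remains.\<close>
lemma bil_S_mat_self:
  assumes char: "CHAR('a::field) = 2" and n: "n = 2 * \<nu> + 2"
  shows "bil n (S_mat \<nu>) x x = (x (n - 1) ^ 2 :: 'a ratfun)"
proof -
  define g where "g j = x (partner \<nu> j) * x j" for j
  have "(\<Sum>j<n. g j) = (\<Sum>j<(\<nu> + \<nu>) + 2. g j)"
    using n by (simp only: mult_2)
  also have "\<dots> = (\<Sum>j<\<nu> + \<nu>. g j) + (\<Sum>j<2. g (\<nu> + \<nu> + j))"
    by (rule sum_lessThan_add)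
  also have "(\<Sum>j<\<nu> + \<nu>. g j) = 0"
  proof -
    have "(\<Sum>j<\<nu>. g (\<nu> + j)) = (\<Sum>j<\<nu>. g j)"
      by (rule sum.cong) (auto simp: g_def partner_def mult.commute add.commute)
    then show ?thesis
      using sum_lessThan_add[of g \<nu> \<nu>] by (simp only: char_2_add_self[OF char])
  qed
  also have "(\<Sum>j<2. g (\<nu> + \<nu> + j)) = 0"
  proof -
    have "partner \<nu> (\<nu> + \<nu>) = \<nu> + \<nu> + 1" "partner \<nu> (\<nu> + \<nu> + 1) = \<nu> + \<nu>"
      by (simp_all add: partner_def)
    then have "g (\<nu> + \<nu> + 1) = g (\<nu> + \<nu>)" by (simp only: g_def mult.commute)
    moreover have "(\<Sum>j<2. g (\<nu> + \<nu> + j)) = g (\<nu> + \<nu>) + g (\<nu> + \<nu> + 1)"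
      by (simp add: numeral_2_eq_2)
    ultimately show ?thesis by (simp only: char_2_add_self[OF char])
  qed
  finally have "(\<Sum>j<n. x (partner \<nu> j) * x j) = 0" by (simp only: g_def add_0_left)
  moreover have "(\<Sum>j<n. (if j = n - 1 then x (n - 1) else 0) * x j) =
      (\<Sum>j<n. if j = n - 1 then x (n - 1) * x j else 0)"
    by (rule sum.cong) auto
  moreover have "n - 1 < n" using n by simp
  ultimately show ?thesis
    by (simp add: bil_S_mat[OF n] distrib_right sum.distrib power2_eq_square)
qed

lemma bil_sum_left:
  "bil n A (\<lambda>l. \<Sum>i\<in>I. x i l * c i) y = (\<Sum>i\<in>I. bil n A (x i) y * c i)"
proof -
  have "bil n A (\<lambda>l. \<Sum>i\<in>I. x i l * c i) y =
      (\<Sum>a<n. \<Sum>b<n. \<Sum>i\<in>I. Const (A $$ (a, b)) * (x i a * y b) * c i)"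
    unfolding bil_def by (simp add: sum_distrib_left sum_distrib_right mult_ac)
  also have "\<dots> = (\<Sum>a<n. \<Sum>i\<in>I. \<Sum>b<n. Const (A $$ (a, b)) * (x i a * y b) * c i)"
    by (rule sum.cong[OF refl]) (rule sum.swap)
  also have "\<dots> = (\<Sum>i\<in>I. \<Sum>a<n. \<Sum>b<n. Const (A $$ (a, b)) * (x i a * y b) * c i)"
    by (rule sum.swap)
  also have "\<dots> = (\<Sum>i\<in>I. bil n A (x i) y * c i)"
    unfolding bil_def by (simp add: sum_distrib_right)
  finally show ?thesis .
qed

text \<open>The system that determines the Dickson coefficients over the field generated by the claimed
invariants. Applied to the vector \<open>v\<close> whose coordinates are \<open>v k = \<Sum>i<n. d i * Var k^(q^i)\<close>, row \<open>j > 0\<close>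
is the pairing with the \<open>q^j\<close>-th powers of the variables, and row 0 is the last coordinate,
that is, the pairing with the basis vector number \<open>n - 2\<close>. These \<open>n\<close> vectors span the whole space: a linear
relation, read off at the coordinates other than \<open>n - 2\<close>, is a Moore relation in \<open>n - 1\<close> variables.
As the form is nondegenerate, \<open>v = 0\<close>, and then \<open>d = 0\<close> by Moore independence. Pairing with the variables
themselves in row 0 would instead require \<open>P_form n S n\<close> on the right-hand side, which is not
among the generators.\<close>
lemma gram_nondegenerate:
  assumes n: "n = 2 * \<nu> + 2"
  shows "nondegenerate n (\<lambda>j i. if j = 0 then Var (n - 1) ^ (CARD('a) ^ i)
    else bil n (S_mat \<nu>) (\<lambda>l. Var l ^ (CARD('a) ^ i)) (\<lambda>l. Var l ^ (CARD('a::{field,finite}) ^ j)) :: 'a ratfun)"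
  unfolding nondegenerate_def
proof (intro allI impI)
  fix d :: "nat \<Rightarrow> 'a ratfun" and i
  assume d: "\<forall>j<n. (\<Sum>i<n. (if j = 0 then Var (n - 1) ^ (CARD('a) ^ i)
    else bil n (S_mat \<nu>) (\<lambda>l. Var l ^ (CARD('a) ^ i)) (\<lambda>l. Var l ^ (CARD('a) ^ j))) * d i) = 0"
    and i: "i < n"
  let ?q = "CARD('a)"
  \<comment> \<open>\<open>w\<close> is the vector \<open>v\<close> times the matrix of the form, and the columns of \<open>Y\<close> are the \<open>n\<close> vectors
     that \<open>v\<close> is paired with.\<close>
  define v where "v k = (\<Sum>i<n. Var k ^ (?q ^ i) * d i)" for k
  define w where "w l = v (partner \<nu> l) + (if l = n - 1 then v (n - 1) else 0)" for l
  define Y :: "nat \<Rightarrow> nat \<Rightarrow> 'a ratfun" where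
    "Y l j = (if j = 0 then if l = n - 2 then 1 else 0 else Var l ^ (?q ^ j))" for l j
  have less: "0 < n" "n - 1 < n" "n - 2 < n" using n by simp_all
  have vn: "v (n - 1) = 0" using d[rule_format, OF less(1)] by (simp add: v_def)
  have vj: "(\<Sum>l<n. Var l ^ (?q ^ j) * w l) = 0" if j: "j < n" "j \<noteq> 0" for j
  proof -
    let ?y = "\<lambda>l. Var l ^ (?q ^ j) :: 'a ratfun"
    have "bil n (S_mat \<nu>) v ?y = (\<Sum>i<n. bil n (S_mat \<nu>) (\<lambda>l. Var l ^ (?q ^ i)) ?y * d i)"
      unfolding v_def by (rule bil_sum_left)
    also have "\<dots> = 0" using d[rule_format, OF j(1)] j(2) by simp
    finally show ?thesis by (simp add: bil_S_mat[OF n] w_def mult.commute)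
  qed
  have "nondegenerate n Y"
    unfolding nondegenerate_def
  proof (intro allI impI)
    fix b j assume b: "\<forall>l<n. (\<Sum>j<n. Y l j * b j) = 0" and j: "j < n"
    have split: "(\<Sum>j<n. Y l j * b j) = Y l 0 * b 0 + (\<Sum>i<n - 1. b (i + 1) * Var l ^ (?q ^ (i + 1)))" for l
    proof -
      have "{..<n} = {..<Suc (n - 1)}" using n by simp
      then show ?thesis by (simp only: sum.lessThan_Suc_shift) (simp add: Y_def mult.commute)
    qed
    have b1: "b (i + 1) = 0" if "i < n - 1" for i
    proof (rule moore_independent[of "{..<n} - {n - 2}" "n - 1" _ 1 i])
      show "(\<Sum>i<n - 1. b (i + 1) * Var l ^ (?q ^ (i + 1))) = 0" if "l \<in> {..<n} - {n - 2}" for l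
        using b[rule_format, of l] split[of l] that by (simp add: Y_def)
    qed (use that less in auto)
    have "b 0 = 0" using b[rule_format, OF less(3)] split[of "n - 2"] b1 by (simp add: Y_def)
    with b1[of "j - 1"] j show "b j = 0" by (cases "j = 0") auto
  qed
  then have YT: "nondegenerate n (\<lambda>j l. Y l j)" by (rule nondegenerate_transpose)
  have w0: "w l = 0" if "l < n" for l
  proof (rule nondegenerateD[OF YT _ that])
    fix j assume j: "j < n"
    show "(\<Sum>l<n. Y l j * w l) = 0"
    proof (cases "j = 0")
      case True
      then have "(\<Sum>l<n. Y l j * w l) = (\<Sum>l<n. if l = n - 2 then w l else 0)"
        by (intro sum.cong) (auto simp: Y_def)
      also have "\<dots> = w (n - 2)" using less by simp
      also have "\<dots> = 0" using n vn by (simp add: w_def partner_def)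
      finally show ?thesis .
    qed (use vj j in \<open>simp add: Y_def\<close>)
  qed
  have v0: "v k = 0" if "k < n" for k
    using w0[of "partner \<nu> k"] that n vn partner_less[of k \<nu>] partner_partner[of k \<nu>]
    by (simp add: w_def split: if_splits)
  show "d i = 0"
    by (rule nondegenerateD[OF moore_nondegenerate[where 'a='a] _ i]) (use v0 in \<open>simp add: v_def\<close>)
qed

section \<open>The invariants of the pseudo-symplectic group\<close>

lemma sigma_fixed_subfield:
  assumes "T \<in> GL n"
  shows "is_subfield {f. sigma n T f = f}"
proof -
  interpret s: field_hom "sigma n T" by (rule sigma_hom) fact
  show ?thesis
    unfolding is_subfield_def by (simp add: s.hom_add s.hom_mult s.hom_uminus s.hom_inverse)
qed

lemma fixed_field_subfield:
  assumes "H \<subseteq> GL n"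
  shows "is_subfield (fixed_field n H)"
proof -
  have K: "is_subfield (adjoin (Var ` {..<n}))" by (rule adjoin_subfield)
  have "is_subfield {f. sigma n T f = f}" if "T \<in> H" for T
    using that assms by (intro sigma_fixed_subfield) auto
  with K show ?thesis
    unfolding fixed_field_def is_subfield_def by auto
qed

lemma P_form_in_adjoin:
  assumes "A \<in> carrier_mat n n"
  shows "P_form n A k \<in> adjoin (Var ` {..<n})"
proof -
  have sr: "is_subring (adjoin (Var ` {..<n}))" by (rule subfield_imp_subring[OF adjoin_subfield])
  show ?thesis
    unfolding P_form_eq_bil[OF assms] bil_def
    by (intro subring_sum[OF sr] subring_mult[OF sr] subring_power[OF sr] adjoin_Const adjoin_gen) auto
qed

text \<open>The form evaluated at the variables themselves is the square of the last variable, and square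
roots are unique in characteristic two.\<close>
lemma Ps_fixes_last_Var:
  fixes T :: "'a::{field,finite} mat"
  assumes char: "CHAR('a) = 2" and n: "n = 2 * \<nu> + 2" and T: "T \<in> Ps n (S_mat \<nu>)"
  shows "sigma n T (Var (n - 1)) = Var (n - 1)"
proof -
  have TGL: "T \<in> GL n" and TS: "T * S_mat \<nu> * transpose_mat T = S_mat \<nu>"
    using T by (auto simp: Ps_def)
  interpret s: field_hom "sigma n T" by (rule sigma_hom) fact
  have S: "S_mat \<nu> \<in> carrier_mat n n" using S_mat_carrier n by simp
  let ?x = "Var (n - 1) :: 'a ratfun"
  have P0: "P_form n (S_mat \<nu>) 0 = ?x ^ 2"
    by (simp add: P_form_eq_bil[OF S] bil_S_mat_self[OF char n])
  have "sigma n T ?x ^ 2 = sigma n T (P_form n (S_mat \<nu>) 0)" by (simp only: P0 s.hom_power)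
  also have "\<dots> = ?x ^ 2" by (subst sigma_P_form[OF TGL S]) (simp only: TS P0)
  finally have "sigma n T ?x ^ 2 = ?x ^ 2" .
  moreover have "(sigma n T ?x + ?x) ^ 2 = sigma n T ?x ^ 2 + ?x ^ 2 + (sigma n T ?x * ?x + sigma n T ?x * ?x)"
    by (simp add: power2_eq_square algebra_simps)
  ultimately have "(sigma n T ?x + ?x) ^ 2 = 0"
    by (simp add: char_2_add_self[OF char])
  then have "sigma n T ?x + ?x = 0" by simp
  with char_2_add_self[OF char, of ?x] show ?thesis by (metis add_right_cancel)
qed

theorem theorem4p3:
  fixes \<nu> n :: nat and S :: "'a::{field,finite} mat"
  assumes "CHAR('a) = 2"
    and "\<nu> \<ge> 1"
    and "n = 2 * \<nu> + 2"
    and "S = S_mat \<nu>"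
  shows "fixed_field n (Ps n S) = adjoin (P_form n S ` {1..n - 1} \<union> {Var (n - 1)})"
proof
  let ?q = "CARD('a)" and ?K = "adjoin (Var ` {..<n}) :: 'a ratfun set"
  let ?L = "adjoin (P_form n S ` {1..n - 1} \<union> {Var (n - 1)})"
  note n = \<open>n = 2 * \<nu> + 2\<close>
  have S: "S \<in> carrier_mat n n" using S_mat_carrier[of \<nu>] assms by simp
  have Ps: "Ps n S \<subseteq> GL n" by (auto simp: Ps_def)
  show "?L \<subseteq> fixed_field n (Ps n S)"
  proof (rule adjoin_least)
    show "is_subfield (fixed_field n (Ps n S))" by (rule fixed_field_subfield) fact
    show "range Const \<subseteq> fixed_field n (Ps n S)"
      using Ps sigma_hom(2) by (auto simp: fixed_field_def adjoin_Const)
    have "P_form n S k \<in> fixed_field n (Ps n S)" for k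
      using sigma_P_form[OF _ S] P_form_in_adjoin[OF S] by (auto simp: fixed_field_def Ps_def)
    moreover have "Var (n - 1) \<in> fixed_field n (Ps n S)"
      using Ps_fixes_last_Var[OF assms(1) n] assms(4) n by (auto simp: fixed_field_def intro!: adjoin_gen)
    ultimately show "P_form n S ` {1..n - 1} \<union> {Var (n - 1)} \<subseteq> fixed_field n (Ps n S)"
      by auto
  qed
  have L: "is_subfield ?L" by (rule adjoin_subfield)
  have sr: "is_subring ?L" using L by (rule subfield_imp_subring)
  have xL: "Var (n - 1) \<in> ?L" by (rule adjoin_gen) simp
  have PL: "P_form n S k \<in> ?L" if "k \<le> n - 1" for k
  proof (cases "k = 0")
    case True
    have "P_form n S 0 = Var (n - 1) ^ 2"
      unfolding P_form_eq_bil[OF S] unfolding assms(4)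
      by (simp add: bil_S_mat_self[OF assms(1) n])
    with True subring_power[OF sr xL, of 2] show ?thesis by (simp only:)
  qed (use that in \<open>auto intro!: adjoin_gen\<close>)
  let ?X = "\<lambda>k l. Var l ^ (?q ^ k) :: 'a ratfun"
  \<comment> \<open>The bound \<open>j \<ge> 1\<close> keeps \<open>i - j\<close> below \<open>n\<close>, so that \<open>P_form n S n\<close> never occurs.\<close>
  have gram: "bil n S (?X i) (?X j) \<in> ?L" if "i \<le> n" "1 \<le> j" "j < n" for i j
  proof -
    have *: "bil n S (?X i) (?X j) \<in> ?L" if "i \<le> j" "j - i \<le> n - 1" for i j
    proof -
      have "bil n S (?X i) (?X j) = P_form n S (j - i) ^ (?q ^ i)"
        using that by (simp add: P_form_eq_bil[OF S] bil_frobenius flip: power_mult power_add)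
      with subring_power[OF sr PL[OF that(2)]] show ?thesis by simp
    qed
    show ?thesis
    proof (cases "i \<le> j")
      case True
      then show ?thesis using that by (intro *) auto
    next
      case False
      then have "bil n S (?X j) (?X i) \<in> ?L" using that by (intro *) auto
      then show ?thesis by (simp add: assms(4) bil_S_mat_commute[OF n, of "?X i"])
    qed
  qed
  obtain c where c: "dickson_coeffs n (c :: nat \<Rightarrow> 'a ratfun)" using dickson_coeffs_exist by blast
  have cL: "c i \<in> ?L" if "i < n" for i
  proof (rule nondegenerate_solution_in_subfield[OF gram_nondegenerate[OF n, where 'a='a] L _ _ that])
    show "(if j = 0 then Var (n - 1) ^ ?q ^ i else bil n (S_mat \<nu>) (?X i) (?X j)) \<in> ?L"
      if "j < n" "i < n" for j i
      using gram[of i j] that xL sr by (auto simp: assms(4) intro: subring_power)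
    have power_n: "?X n l = (\<Sum>i<n. ?X i l * c i)" if "l < n" for l
      using c that by (simp add: dickson_coeffs_def mult.commute)
    show "(\<Sum>i<n. (if j = 0 then Var (n - 1) ^ ?q ^ i else bil n (S_mat \<nu>) (?X i) (?X j)) * c i) \<in> ?L"
      if "j < n" for j
    proof (cases "j = 0")
      case True
      then show ?thesis using power_n[of "n - 1"] subring_power[OF sr xL, of "?q ^ n"] n by simp
    next
      case False
      have "bil n S (?X n) (?X j) = bil n S (\<lambda>l. \<Sum>i<n. ?X i l * c i) (?X j)"
        by (rule bil_cong) (use power_n in auto)
      also have "\<dots> = (\<Sum>i<n. bil n S (?X i) (?X j) * c i)"
        by (rule bil_sum_left)
      finally show ?thesis using gram[of n j] False that by (simp add: assms(4))
    qed
  qed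
  have GL_L: "fixed_field n (GL n) \<subseteq> ?L"
  proof
    fix f :: "'a ratfun" assume f: "f \<in> fixed_field n (GL n)"
    \<comment> \<open>Intersecting with the invariants yields a field of invariants that contains the Dickson
       coefficients.\<close>
    have "f \<in> ?L \<inter> {f. \<forall>T\<in>GL n. sigma n T f = f}"
    proof (rule GL_invariants[OF _ _ _ c _ f])
      have "is_subfield {f :: 'a ratfun. \<forall>T\<in>GL n. sigma n T f = f}"
        using sigma_fixed_subfield unfolding is_subfield_def by auto
      with L show "is_subfield (?L \<inter> {f. \<forall>T\<in>GL n. sigma n T f = f})"
        unfolding is_subfield_def by auto
      show "range Const \<subseteq> ?L \<inter> {f. \<forall>T\<in>GL n. sigma n T f = f}"
        using sigma_hom(2) by (auto simp: adjoin_Const)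
    qed (use cL dickson_coeffs_invariant[OF c] in auto)
    then show "f \<in> ?L" by simp
  qed
  show "fixed_field n (Ps n S) \<subseteq> ?L"
  proof
    fix f assume f: "f \<in> fixed_field n (Ps n S)"
    show "f \<in> ?L"
    proof (rule invariant_in_field_of_orbit_point[of f n "P_form n S 1"])
      show "f \<in> ?K" using f by (simp add: fixed_field_def)
      show "P_form n S 1 \<in> ?K" by (rule P_form_in_adjoin) fact
      show "sigma n T f = f" if T: "T \<in> GL n" and "sigma n T (P_form n S 1) = P_form n S 1" for T
      proof -
        have "T \<in> carrier_mat n n" using T by (simp add: GL_def)
        then have "T * S * transpose_mat T \<in> carrier_mat n n" using S by simp
        moreover have "P_form n (T * S * transpose_mat T) 1 = P_form n S 1"
          using that sigma_P_form[OF T S] by simp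
        ultimately have "T * S * transpose_mat T = S" using S by (intro P_form_1_inj)
        with T have "T \<in> Ps n S" by (simp add: Ps_def)
        with f show ?thesis by (simp add: fixed_field_def)
      qed
      show "P_form n S 1 \<in> ?L" using PL[of 1] n by simp
    qed (use L GL_L in auto)
  qed
qed

end
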